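(* Let $\mathbb{T}$ be a time scale with $\sup\mathbb{T}=+\infty$ and $\bar\mu_\mathbb{T}:=\sup_{t\in\mathbb{T}}\mu_\mathbb{T}(t)<+\infty$, and let $A$ be a real $n\times n$ matrix such that the system $x^\Delta=Ax$ on $\mathbb{T}$ is positive. Then $x^\Delta=Ax$ is positively uniformly exponentially stable if and only if all coefficients of the characteristic polynomial $\chi_A(\lambda)=\det(\lambda I-A)$ are positive.
   Context: A time scale is a nonempty closed subset $\mathbb{T}\subset\mathbb{R}$. For $t\in\mathbb{T}$, $\sigma_\mathbb{T}(t)=\inf\{s\in\mathbb{T}:s>t\}$ and the graininess is $\mu_\mathbb{T}(t)=\sigma_\mathbb{T}(t)-t$. The delta derivative $f^\Delta(t)$ is the number such that for every $\varepsilon>0$ there is $\delta>0$ with $|f(\sigma_\mathbb{T}(t))-f(s)-f^\Delta(t)(\sigma_\mathbb{T}(t)-s)|\le\varepsilon|\sigma_\mathbb{T}(t)-s|$ for all $s\in\mathbb{T}$, $|s-t|<\delta$ (ordinary derivative on $\mathbb{R}$, forward difference quotient $(f(t+h)-f(t))/h$ on $h\mathbb{Z}$). For $t_0\in\mathbb{T}$ and $x_0\in\mathbb{R}^n$ the system $x^\Delta=Ax$ has a unique forward solution with $x(t_0)=x_0$. The system $x^\Delta=Ax$ is positive if for every $t_0\in\mathbb{T}$ and every $x_0\in\mathbb{R}^n_+$ (vectors with nonnegative entries) the solution with $x(t_0)=x_0$ stays in $\mathbb{R}^n_+$ for all $t\ge t_0$. It is positively uniformly exponentially stable if there exist $K\ge1$,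 $\alpha>0$ and an open neighborhood $V$ of $0$ in $\mathbb{R}^n$ such that for all $t_0\le t$ in $\mathbb{T}$ and all $x_0\in\mathbb{R}^n_+\cap V$ the solution with $x(t_0)=x_0$ satisfies $\|x(t)\|\le K e^{-\alpha(t-t_0)}\|x_0\|$. *)

theory Defs
  imports "HOL-Analysis.Analysis" "HOL-Computational_Algebra.Polynomial"
begin

definition time_scale :: "real set \<Rightarrow> bool" where
  "time_scale T \<longleftrightarrow> T \<noteq> {} \<and> closed T"

text \<open>Forward jump operator (with the convention sigma t = t at a maximum).\<close>
definition sigma_ts :: "real set \<Rightarrow> real \<Rightarrow> real" where
  "sigma_ts T t = (if {s\<in>T. s > t} = {} then t else Inf {s\<in>T. s > t})"

definition graininess :: "real set \<Rightarrow> real \<Rightarrow> real" where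
  "graininess T t = sigma_ts T t - t"

text \<open>Delta derivative of a vector-valued function at t on the time scale T.\<close>
definition has_delta_derivative ::
  "real set \<Rightarrow> (real \<Rightarrow> 'a::real_normed_vector) \<Rightarrow> real \<Rightarrow> 'a \<Rightarrow> bool" where
  "has_delta_derivative T f t D \<longleftrightarrow>
     (\<forall>\<epsilon>>0. \<exists>\<delta>>0. \<forall>s\<in>T. \<bar>s - t\<bar> < \<delta> \<longrightarrow>
        norm (f (sigma_ts T t) - f s - (sigma_ts T t - s) *\<^sub>R D) \<le> \<epsilon> * \<bar>sigma_ts T t - s\<bar>)"

text \<open>x is a forward solution of x^Delta = A x on T with x(t0) = x0: it satisfies the
  equation on the time scale T \<inter> [t0, \<infinity>).\<close>
definition forward_solution ::
  "real set \<Rightarrow> real^'n^'n \<Rightarrow> real \<Rightarrow> real^'n \<Rightarrow> (real \<Rightarrow> real^'n) \<Rightarrow> bool" where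
  "forward_solution T A t0 x0 x \<longleftrightarrow>
     x t0 = x0 \<and>
     (\<forall>t\<in>T. t0 \<le> t \<longrightarrow> has_delta_derivative {s\<in>T. t0 \<le> s} x t (A *v x t))"

definition nonneg_vec :: "real^'n \<Rightarrow> bool" where
  "nonneg_vec v \<longleftrightarrow> (\<forall>i. 0 \<le> v $ i)"

definition positive_system :: "real set \<Rightarrow> real^'n^'n \<Rightarrow> bool" where
  "positive_system T A \<longleftrightarrow>
     (\<forall>t0\<in>T. \<forall>x0. nonneg_vec x0 \<longrightarrow> (\<forall>x. forward_solution T A t0 x0 x \<longrightarrow>
        (\<forall>t\<in>T. t0 \<le> t \<longrightarrow> nonneg_vec (x t))))"

definition pos_unif_exp_stable :: "real set \<Rightarrow> real^'n^'n \<Rightarrow> bool" where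
  "pos_unif_exp_stable T A \<longleftrightarrow>
     (\<exists>K \<alpha> V. K \<ge> 1 \<and> \<alpha> > 0 \<and> open V \<and> (0::real^'n) \<in> V \<and>
        (\<forall>t0\<in>T. \<forall>t\<in>T. t0 \<le> t \<longrightarrow> (\<forall>x0. nonneg_vec x0 \<and> x0 \<in> V \<longrightarrow>
           (\<forall>x. forward_solution T A t0 x0 x \<longrightarrow>
               norm (x t) \<le> K * exp (- \<alpha> * (t - t0)) * norm x0))))"

text \<open>Characteristic polynomial det(lambda I - A).\<close>
definition charpoly :: "real^'n^'n \<Rightarrow> real poly" where
  "charpoly A = det (\<chi> i j. (if i = j then [:0, 1:] else 0) - [: A $ i $ j :])"

end

(*
  Positivity of x\<^sup>\<Delta> = A x forces A to be a Metzler matrix. For a Metzler matrix, Brouwer's fixed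
  point theorem together with Gordan's alternative gives a dichotomy: either A has a nonnegative
  eigenvector with a nonnegative eigenvalue, or some strictly positive v satisfies v\<^sup>T A < 0.
  In the first case the solution through the eigenvector never decays, and the eigenvalue is a
  nonnegative root of the characteristic polynomial, so its coefficients are not all positive.
  In the second case x \<mapsto> v \<bullet> x is a Lyapunov function on the nonnegative orthant, which gives
  uniform exponential decay of all positive solutions, and a Gershgorin argument places every
  eigenvalue in the open left half-plane, which forces positive coefficients (Stodola).
  Solutions exist because the series \<Sum>\<^sub>k h\<^sub>k(t, t0) A\<^sup>k x0 over the time scale monomials converges.
*)

theory Submission
  imports Defs "HOL-Computational_Algebra.Fundamental_Theorem_Algebra"
begin

section \<open>The characteristic polynomial\<close>

lemma det_map_matrix_hom:
  fixes h :: "'a::comm_ring_1 \<Rightarrow> 'b::comm_ring_1"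
  assumes add: "\<And>a b. h (a + b) = h a + h b" and mult: "\<And>a b. h (a * b) = h a * h b"
    and zero: "h 0 = 0" and one: "h 1 = 1"
  shows "h (det M) = det (map_matrix h M)"
proof -
  have hom_prod: "h (prod f UNIV) = (\<Prod>i\<in>UNIV. h (f i))" for f :: "'n \<Rightarrow> 'a"
    by (induction rule: infinite_finite_induct) (auto simp: mult one)
  have hom_uminus: "h (- a) = - h a" for a
    using add[of a "- a"] zero by (metis minus_unique right_minus)
  have hom_sign: "h (of_int (sign p)) = of_int (sign p)" for p :: "'n \<Rightarrow> 'n"
    by (auto simp: sign_def hom_uminus one)
  show ?thesis
    unfolding det_def sum_comp_morphism[of h, OF zero add, symmetric]
    by (simp add: hom_prod hom_sign mult)
qed

lemma poly_charpoly: "poly (charpoly A) s = det (mat s - A)"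
proof -
  have "map_matrix (\<lambda>p. poly p s) (\<chi> i j. (if i = j then [:0, 1:] else 0) - [:A$i$j:]) = mat s - A"
    by (simp add: mat_def vec_eq_iff)
  then show ?thesis
    unfolding charpoly_def by (subst det_map_matrix_hom[where h = "\<lambda>p. poly p s"]) auto
qed

lemma map_poly_of_real_add:
  "map_poly (of_real :: real \<Rightarrow> 'a::real_algebra_1) (p + q) = map_poly of_real p + map_poly of_real q"
  by (rule poly_eqI) (simp add: coeff_map_poly)

lemma map_poly_of_real_mult:
  "map_poly (of_real :: real \<Rightarrow> 'a::{real_algebra_1,comm_ring_1}) (p * q) =
     map_poly of_real p * map_poly of_real q"
  by (rule poly_eqI) (simp add: coeff_map_poly coeff_mult)

lemma poly_map_poly_of_real_charpoly:
  "poly (map_poly of_real (charpoly A)) z = det (mat z - map_matrix complex_of_real A)"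
proof -
  have "map_matrix (\<lambda>p. poly (map_poly of_real p) z)
      (\<chi> i j. (if i = j then [:0, 1:] else 0) - [:A$i$j:]) = mat z - map_matrix of_real A"
    by (simp add: map_poly_pCons mat_def vec_eq_iff)
  then show ?thesis
    unfolding charpoly_def
    by (subst det_map_matrix_hom[where h = "\<lambda>p. poly (map_poly of_real p) z"])
       (auto simp: map_poly_of_real_add map_poly_of_real_mult)
qed

lemma charpoly_Leibniz:
  fixes A :: "real^'n^'n"
  shows "charpoly A = (\<Sum>p | p permutes (UNIV :: 'n set).
     of_int (sign p) * (\<Prod>i\<in>UNIV. if p i = i then [:- A$i$i, 1:] else [:- A$i$(p i):]))"
  unfolding charpoly_def det_def by (intro sum.cong refl arg_cong2[where f = "(*)"] prod.cong) auto

lemma degree_charpoly_term: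
  fixes A :: "real^'n^'n"
  shows "degree (\<Prod>i\<in>UNIV. if p i = i then [:- A$i$i, 1:] else [:- A$i$(p i):]) \<le> card {i. p i = i}"
proof -
  have "degree (\<Prod>i\<in>UNIV. if p i = i then [:- A$i$i, 1:] else [:- A$i$(p i):])
      \<le> (\<Sum>i\<in>UNIV. degree (if p i = i then [:- A$i$i, 1:] else [:- A$i$(p i):]))"
    by (rule order.trans[OF degree_prod_sum_le]) (simp_all add: o_def)
  also have "\<dots> \<le> (\<Sum>i\<in>UNIV. if p i = i then 1 else 0)"
    by (intro sum_mono) auto
  finally show ?thesis
    by (simp add: sum.If_cases)
qed

lemma
  fixes A :: "real^'n^'n"
  shows degree_charpoly: "degree (charpoly A) = CARD('n)"
    and lead_coeff_charpoly: "lead_coeff (charpoly A) = 1"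
proof -
  define Q where "Q p = (\<Prod>i\<in>UNIV. if p i = i then [:- A$i$i, 1:] else [:- A$i$(p i):])"
    for p :: "'n \<Rightarrow> 'n"
  have degree_Q: "degree (of_int (sign p) * Q p) \<le> card {i. p i = i}" for p
    using degree_charpoly_term[where A = A and p = p] by (auto simp: Q_def sign_def)
  have "degree (of_int (sign p) * Q p) \<le> CARD('n)" for p
    using degree_Q[of p] card_mono[of UNIV "{i. p i = i}"] by simp
  then have le: "degree (charpoly A) \<le> CARD('n)"
    unfolding charpoly_Leibniz Q_def[symmetric] by (intro degree_sum_le) (auto simp: finite_permutations)
  \<comment> \<open>only the identity permutation contributes a term of full degree\<close>
  have "coeff (of_int (sign p) * Q p) CARD('n) = 0" if p: "p \<noteq> id" for p
  proof -
    obtain i where "p i \<noteq> i" using p by (auto simp: fun_eq_iff)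
    then have "card {i. p i = i} < CARD('n)"
      by (intro psubset_card_mono) auto
    then show ?thesis using degree_Q[of p] by (intro coeff_eq_0) auto
  qed
  then have "coeff (charpoly A) CARD('n) = coeff (Q id) CARD('n)"
    unfolding charpoly_Leibniz Q_def[symmetric] coeff_sum
    by (subst sum.remove[of _ id]) (auto simp: finite_permutations permutes_id intro!: sum.neutral)
  also have "\<dots> = 1"
  proof -
    have "degree (Q id) = CARD('n)"
      by (simp add: Q_def degree_prod_sum_eq)
    moreover have "lead_coeff (Q id) = 1"
      by (simp add: Q_def lead_coeff_prod)
    ultimately show ?thesis by simp
  qed
  finally have "coeff (charpoly A) CARD('n) = 1" .
  with le show "degree (charpoly A) = CARD('n)"
    by (metis le_antisym le_degree zero_neq_one)
  with \<open>coeff (charpoly A) CARD('n) = 1\<close> show "lead_coeff (charpoly A) = 1"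
    by simp
qed

section \<open>Stodola's condition\<close>

definition pos_coeffs :: "real poly \<Rightarrow> bool" where
  "pos_coeffs p \<longleftrightarrow> (\<forall>k \<le> degree p. coeff p k > 0)"

definition complex_root :: "real poly \<Rightarrow> complex \<Rightarrow> bool" where
  "complex_root p z \<longleftrightarrow> poly (map_poly of_real p) z = 0"

lemma pos_coeffs_nonneg: "pos_coeffs p \<Longrightarrow> coeff p k \<ge> 0"
  unfolding pos_coeffs_def by (cases "k \<le> degree p") (auto simp: coeff_eq_0 less_imp_le)

lemma pos_coeffs_nonzero: "pos_coeffs p \<Longrightarrow> p \<noteq> 0"
  unfolding pos_coeffs_def by auto

lemma pos_coeffs_mult:
  assumes p: "pos_coeffs p" and q: "pos_coeffs q"
  shows "pos_coeffs (p * q)"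
  unfolding pos_coeffs_def
proof (intro allI impI)
  fix k assume "k \<le> degree (p * q)"
  then have k: "k \<le> degree p + degree q"
    using degree_mult_le order.trans by blast
  define i where "i = min k (degree p)"
  have "0 < coeff p i * coeff q (k - i)"
    using p q k by (auto simp: pos_coeffs_def i_def)
  also have "\<dots> \<le> (\<Sum>j\<le>k. coeff p j * coeff q (k - j))"
    using pos_coeffs_nonneg[OF p] pos_coeffs_nonneg[OF q]
    by (intro member_le_sum) (auto simp: i_def)
  finally show "0 < coeff (p * q) k"
    by (simp add: coeff_mult)
qed

lemma complex_root_mult: "complex_root (p * q) z \<longleftrightarrow> complex_root p z \<or> complex_root q z"
  by (simp add: complex_root_def map_poly_of_real_mult)

lemma complex_root_of_real: "complex_root p (of_real a) \<longleftrightarrow> poly p a = 0"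
proof -
  have "poly (map_poly of_real p) (of_real a) = (of_real (poly p a) :: complex)"
    by (induction p) (auto simp: map_poly_pCons)
  then show ?thesis
    by (simp add: complex_root_def)
qed

text \<open>A non-real root brings its conjugate along, hence a real quadratic factor.\<close>

lemma complex_root_quadratic_dvd:
  assumes root: "complex_root p z" and nonreal: "Im z \<noteq> 0"
  shows "[:(cmod z)^2, - 2 * Re z, 1:] dvd p"
proof -
  define Q where "Q = [:(cmod z)^2, - 2 * Re z, 1:]"
  have "poly (map_poly of_real Q) z = of_real ((cmod z)^2) - 2 * of_real (Re z) * z + z * z"
    by (simp add: Q_def map_poly_pCons algebra_simps)
  also have "\<dots> = 0"
    using cmod_power2[of z] by (simp add: complex_eq_iff power2_eq_square algebra_simps)
  finally have "complex_root Q z"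
    by (simp add: complex_root_def)
  define r where "r = p mod Q"
  have "degree r < degree Q \<or> r = 0"
    unfolding r_def Q_def by (metis degree_mod_less' pCons_eq_0_iff zero_neq_one)
  then have r_linear: "r = [:coeff r 0, coeff r 1:]"
    by (intro poly_eqI) (auto simp: Q_def coeff_pCons coeff_eq_0 split: nat.split)
  have "p = p div Q * Q + r"
    by (simp add: r_def)
  then have "complex_root r z"
    using root \<open>complex_root Q z\<close> unfolding complex_root_def
    by (metis add_0 map_poly_of_real_add map_poly_of_real_mult mult_zero_right poly_add poly_mult)
  then have "of_real (coeff r 0) + of_real (coeff r 1) * z = 0"
    by (subst (asm) r_linear) (simp add: complex_root_def map_poly_pCons mult.commute)
  then have "coeff r 1 = 0" "coeff r 0 = 0"
    using nonreal by (auto simp: complex_eq_iff)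
  then have "r = 0"
    by (subst r_linear) simp
  then show ?thesis
    by (simp add: Q_def r_def mod_eq_0_iff_dvd)
qed

lemma left_half_plane_root_factor:
  assumes root: "complex_root p z" and left: "Re z < 0"
  obtains f where "f dvd p" "pos_coeffs f" "lead_coeff f = 1" "degree f > 0"
proof (cases "Im z = 0")
  case True
  then have "poly p (Re z) = 0"
    using root complex_root_of_real by (metis complex_is_Real_iff of_real_Re)
  then have "[:- Re z, 1:] dvd p"
    by (simp add: poly_eq_0_iff_dvd)
  moreover have "pos_coeffs [:- Re z, 1:]"
    using left by (auto simp: pos_coeffs_def less_Suc_eq_le[symmetric] less_Suc_eq)
  ultimately show ?thesis
    using that by simp
next
  case False
  then have "[:(cmod z)^2, - 2 * Re z, 1:] dvd p"
    using complex_root_quadratic_dvd root by blast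
  moreover have "(cmod z)^2 > 0"
    using False by (auto simp: complex_eq_iff)
  then have "pos_coeffs [:(cmod z)^2, - 2 * Re z, 1:]"
    using left by (auto simp: pos_coeffs_def numeral_2_eq_2 le_Suc_eq)
  ultimately show ?thesis
    using that by simp
qed

theorem pos_coeffs_if_roots_in_left_half_plane:
  assumes "lead_coeff p > 0" and "\<And>z. complex_root p z \<Longrightarrow> Re z < 0"
  shows "pos_coeffs p"
  using assms
proof (induction "degree p" arbitrary: p rule: less_induct)
  case less
  show ?case
  proof (cases "degree p = 0")
    case True
    then show ?thesis
      using less.prems by (simp add: pos_coeffs_def)
  next
    case False
    have "\<not> constant (poly (map_poly (of_real :: real \<Rightarrow> complex) p))"
      using False by (simp add: constant_degree degree_map_poly)
    then obtain z where "complex_root p z"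
      using fundamental_theorem_of_algebra unfolding complex_root_def by blast
    then obtain f where f: "f dvd p" "pos_coeffs f" "lead_coeff f = 1" "degree f > 0"
      using left_half_plane_root_factor less.prems(2) by blast
    then obtain q where p: "p = f * q"
      by blast
    have "q \<noteq> 0"
      using p less.prems(1) by auto
    moreover have "f \<noteq> 0"
      using f(2) pos_coeffs_nonzero by blast
    ultimately have "degree p = degree f + degree q" "lead_coeff q = lead_coeff p"
      using f(3) lead_coeff_mult[of f q] by (simp_all add: p degree_mult_eq)
    moreover have "complex_root q w \<Longrightarrow> Re w < 0" for w
      using less.prems(2) p complex_root_mult by blast
    ultimately have "pos_coeffs q"
      using less.hyps f(4) less.prems(1) by auto
    then show ?thesis
      using p f(2) pos_coeffs_mult by blast
  qed
qed

section \<open>Metzler matrices\<close>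

definition metzler :: "real^'n^'n \<Rightarrow> bool" where
  "metzler N \<longleftrightarrow> (\<forall>i j. i \<noteq> j \<longrightarrow> 0 \<le> N$i$j)"

definition nonneg_eigenpair :: "real^'n^'n \<Rightarrow> bool" where
  "nonneg_eigenpair N \<longleftrightarrow> (\<exists>w s. nonneg_vec w \<and> w \<noteq> 0 \<and> 0 \<le> s \<and> N *v w = s *\<^sub>R w)"

text \<open>The weights of a linear Lyapunov function \<open>x \<mapsto> v \<bullet> x\<close> on the nonnegative orthant.\<close>

definition copositive_lyapunov :: "real^'n^'n \<Rightarrow> real^'n \<Rightarrow> bool" where
  "copositive_lyapunov N v \<longleftrightarrow> (\<forall>i. 0 < v$i) \<and> (\<forall>j. (v v* N)$j < 0)"

definition unit_simplex :: "(real^'n) set" where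
  "unit_simplex = {w. nonneg_vec w \<and> (\<Sum>i\<in>UNIV. w$i) = 1}"

lemma closed_nonneg_vec: "closed {w :: real^'n. nonneg_vec w}"
  using closed_positive_orthant by (simp add: nonneg_vec_def)

lemma convex_nonneg_vec: "convex {w :: real^'n. nonneg_vec w}"
  unfolding nonneg_vec_def by (rule convex_box_cart) (simp add: atLeast_def[symmetric])

lemma compact_unit_simplex: "compact (unit_simplex :: (real^'n) set)"
proof (rule compact_eq_bounded_closed[THEN iffD2, OF conjI])
  have "norm w \<le> 1" if "w \<in> unit_simplex" for w :: "real^'n"
    using norm_le_l1_cart[of w] that by (simp add: unit_simplex_def nonneg_vec_def)
  then show "bounded (unit_simplex :: (real^'n) set)"
    unfolding bounded_iff by blast
  have "unit_simplex = {w::real^'n. nonneg_vec w} \<inter> {w. (\<Sum>i\<in>UNIV. w$i) = 1}"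
    by (auto simp: unit_simplex_def)
  moreover have "closed {w::real^'n. (\<Sum>i\<in>UNIV. w$i) = 1}"
    by (intro closed_Collect_eq continuous_intros)
  ultimately show "closed (unit_simplex :: (real^'n) set)"
    using closed_nonneg_vec by (metis closed_Int)
qed

lemma convex_unit_simplex: "convex (unit_simplex :: (real^'n) set)"
  unfolding unit_simplex_def convex_def nonneg_vec_def
  by (auto simp: sum.distrib sum_distrib_left[symmetric])

lemma nonneg_vec_sum_pos:
  assumes "nonneg_vec y" "y \<noteq> 0"
  shows "0 < (\<Sum>i\<in>UNIV. y$i)"
proof -
  obtain i where "y$i \<noteq> 0"
    using assms(2) by (auto simp: vec_eq_iff)
  then have "0 < y$i"
    using assms(1) by (auto simp: nonneg_vec_def order.order_iff_strict)
  also have "y$i \<le> (\<Sum>i\<in>UNIV. y$i)"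
    using assms(1) by (intro member_le_sum) (auto simp: nonneg_vec_def)
  finally show ?thesis .
qed

lemma closed_nonneg_vec_image: "closed {w :: real^'n. nonneg_vec (N *v w)}"
  using continuous_closed_vimage[OF closed_nonneg_vec matrix_vector_mult_linear_continuous_at]
  by (simp add: vimage_def)

lemma convex_nonneg_vec_image: "convex {w :: real^'n. nonneg_vec (N *v w)}"
  using convex_linear_vimage[OF matrix_vector_mul_linear convex_nonneg_vec, of N]
  by (simp add: vimage_def)

lemma metzler_shift:
  fixes N :: "real^'n^'n"
  assumes "metzler N"
  obtains c where "0 \<le> c" "\<And>u i. nonneg_vec u \<Longrightarrow> u$i \<le> (N *v u + c *\<^sub>R u)$i"
proof
  define c where "c = 1 + (\<Sum>i\<in>UNIV. \<bar>N$i$i\<bar>)"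
  show "0 \<le> c"
    by (simp add: c_def sum_nonneg add_nonneg_nonneg)
  fix u :: "real^'n" and i :: 'n assume u: "nonneg_vec u"
  have "1 \<le> N$i$i + c"
    using member_le_sum[of i UNIV "\<lambda>i. \<bar>N$i$i\<bar>"] by (simp add: c_def)
  then have "u$i \<le> (N$i$i + c) * u$i"
    using u mult_right_mono[of 1 "N$i$i + c" "u$i"] by (simp add: nonneg_vec_def)
  also have "N$i$i * u$i \<le> (N *v u)$i"
  proof -
    have "(N *v u)$i = N$i$i * u$i + (\<Sum>j\<in>UNIV - {i}. N$i$j * u$j)"
      by (simp add: matrix_vector_mult_def sum.remove[of _ i])
    moreover have "0 \<le> (\<Sum>j\<in>UNIV - {i}. N$i$j * u$j)"
      using assms u by (intro sum_nonneg) (auto simp: metzler_def nonneg_vec_def)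
    ultimately show ?thesis by linarith
  qed
  then have "(N$i$i + c) * u$i \<le> (N *v u + c *\<^sub>R u)$i"
    by (simp add: algebra_simps)
  finally show "u$i \<le> (N *v u + c *\<^sub>R u)$i" .
qed

text \<open>Brouwer's fixed point theorem applied to the normalised map \<open>w \<mapsto> (N + c I) w\<close> on the
  simplex slice where \<open>N w \<ge> 0\<close>: a fixed point is an eigenvector whose eigenvalue is
  forced to be nonnegative by \<open>N w \<ge> 0\<close>.\<close>

lemma metzler_nonneg_eigenpair:
  assumes met: "metzler N" and y: "nonneg_vec y" "y \<noteq> 0" "nonneg_vec (N *v y)"
  shows "nonneg_eigenpair N"
proof -
  obtain c where c: "0 \<le> c" "\<And>u i. nonneg_vec u \<Longrightarrow> u$i \<le> (N *v u + c *\<^sub>R u)$i"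
    using metzler_shift[OF met] by blast
  define B where "B w = N *v w + c *\<^sub>R w" for w
  define \<sigma> where "\<sigma> w = (\<Sum>i\<in>UNIV. B w $ i)" for w
  define f where "f w = (1 / \<sigma> w) *\<^sub>R B w" for w
  define K where "K = unit_simplex \<inter> {w. nonneg_vec (N *v w)}"
  have B_nonneg: "nonneg_vec (B u)" if "nonneg_vec u" for u
    using c(2)[OF that] that by (auto simp: B_def nonneg_vec_def intro: order.trans)
  have \<sigma>_ge_1: "1 \<le> \<sigma> w" if "w \<in> K" for w
    using that sum_mono[of UNIV "\<lambda>i. w$i" "\<lambda>i. B w $ i"] c(2)
    by (auto simp: K_def unit_simplex_def \<sigma>_def B_def)
  have "compact K"
    unfolding K_def by (intro compact_Int_closed compact_unit_simplex closed_nonneg_vec_image)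
  moreover have "convex K"
    unfolding K_def by (intro convex_Int convex_unit_simplex convex_nonneg_vec_image)
  moreover have "(1 / (\<Sum>i\<in>UNIV. y$i)) *\<^sub>R y \<in> K"
    using y nonneg_vec_sum_pos[OF y(1,2)]
    by (auto simp: K_def unit_simplex_def nonneg_vec_def matrix_vector_mult_scaleR
        sum_divide_distrib[symmetric])
  moreover have "continuous_on K f"
    unfolding f_def \<sigma>_def B_def using \<sigma>_ge_1
    by (intro continuous_intros linear_continuous_on matrix_vector_mul_linear)
       (force simp: \<sigma>_def B_def)
  moreover have "f \<in> K \<rightarrow> K"
  proof
    fix w assume w: "w \<in> K"
    then have "nonneg_vec w" "nonneg_vec (N *v w)"
      by (auto simp: K_def unit_simplex_def)
    moreover have "N *v f w = (1 / \<sigma> w) *\<^sub>R B (N *v w)"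
      by (simp add: f_def B_def matrix_vector_mult_scaleR matrix_vector_right_distrib)
    ultimately show "f w \<in> K"
      using \<sigma>_ge_1[OF w] B_nonneg
      by (auto simp: K_def unit_simplex_def f_def \<sigma>_def nonneg_vec_def sum_divide_distrib[symmetric])
  qed
  ultimately obtain w where w: "w \<in> K" "f w = w"
    using brouwer by (metis empty_iff)
  have "B w = \<sigma> w *\<^sub>R f w"
    using \<sigma>_ge_1[OF w(1)] by (simp add: f_def)
  then have "B w = \<sigma> w *\<^sub>R w"
    using w(2) by simp
  then have Nw: "N *v w = (\<sigma> w - c) *\<^sub>R w"
    by (simp add: B_def algebra_simps)
  have w_nonneg: "nonneg_vec w" "nonneg_vec (N *v w)" and "w \<noteq> 0"
    using w(1) by (auto simp: K_def unit_simplex_def)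
  obtain i where "w$i \<noteq> 0"
    using \<open>w \<noteq> 0\<close> by (auto simp: vec_eq_iff)
  then have "0 < w$i"
    using w_nonneg(1) by (auto simp: nonneg_vec_def order.order_iff_strict)
  moreover have "0 \<le> (\<sigma> w - c) * w$i"
    using w_nonneg(2) Nw by (auto simp: nonneg_vec_def vec_eq_iff)
  ultimately have "0 \<le> \<sigma> w - c"
    by (simp add: zero_le_mult_iff)
  then show ?thesis
    unfolding nonneg_eigenpair_def using w_nonneg \<open>w \<noteq> 0\<close> Nw by blast
qed

lemma copositive_lyapunov_perturb:
  fixes N :: "real^'n^'n"
  assumes a: "nonneg_vec a" and neg: "\<And>j. (a v* N)$j < 0"
  obtains v where "copositive_lyapunov N v"
proof
  define m where "m = Max (range (\<lambda>j. (a v* N)$j))"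
  have "m < 0"
    using neg by (simp add: m_def)
  have a_le: "(a v* N)$j \<le> m" for j
    by (simp add: m_def)
  define C where "C = 1 + (\<Sum>i\<in>UNIV. \<Sum>j\<in>UNIV. \<bar>N$i$j\<bar>)"
  have "1 \<le> C"
    by (simp add: C_def sum_nonneg)
  have col: "\<bar>\<Sum>i\<in>UNIV. N$i$j\<bar> \<le> C" for j
  proof -
    have "\<bar>\<Sum>i\<in>UNIV. N$i$j\<bar> \<le> (\<Sum>i\<in>UNIV. \<bar>N$i$j\<bar>)"
      by (rule sum_abs)
    also have "\<dots> \<le> (\<Sum>i\<in>UNIV. \<Sum>j\<in>UNIV. \<bar>N$i$j\<bar>)"
      by (intro sum_mono member_le_sum) auto
    finally show ?thesis
      by (simp add: C_def)
  qed
  define \<eta> where "\<eta> = - m / (2 * C)"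
  have "0 < \<eta>" and "\<eta> * C = - m / 2"
    using \<open>m < 0\<close> \<open>1 \<le> C\<close> by (simp_all add: \<eta>_def divide_neg_pos)
  define v where "v = a + \<eta> *\<^sub>R vec 1"
  have "0 < v$i" for i
    using a \<open>0 < \<eta>\<close> by (simp add: v_def nonneg_vec_def add_nonneg_pos)
  moreover have "(v v* N)$j < 0" for j
  proof -
    have "(v v* N)$j = (a v* N)$j + \<eta> * (\<Sum>i\<in>UNIV. N$i$j)"
      by (simp add: v_def vector_matrix_mult_def algebra_simps sum.distrib sum_distrib_left)
    also have "\<dots> \<le> m + \<eta> * C"
      using a_le[of j] col[of j] \<open>0 < \<eta>\<close> by (intro add_mono mult_left_mono) auto
    finally show ?thesis
      using \<open>\<eta> * C = - m / 2\<close> \<open>m < 0\<close> by linarith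
  qed
  ultimately show "copositive_lyapunov N v"
    by (simp add: copositive_lyapunov_def)
qed

text \<open>Gordan's alternative: separate the compact convex set \<open>N \<Delta>\<close> (\<open>\<Delta>\<close> the unit simplex) from
  the nonnegative orthant.\<close>

lemma copositive_lyapunov_if_no_nonneg_image:
  fixes N :: "real^'n^'n"
  assumes no: "\<nexists>y. nonneg_vec y \<and> y \<noteq> 0 \<and> nonneg_vec (N *v y)"
  obtains v where "copositive_lyapunov N v"
proof -
  define S where "S = (*v) N ` unit_simplex"
  define P where "P = {u::real^'n. nonneg_vec u}"
  have axis_simplex: "axis j 1 \<in> unit_simplex" for j :: 'n
    by (simp add: unit_simplex_def nonneg_vec_def axis_def)
  have "convex S"
    unfolding S_def by (rule convex_linear_image[OF matrix_vector_mul_linear convex_unit_simplex])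
  moreover have "compact S"
    unfolding S_def
    by (intro compact_continuous_image compact_unit_simplex matrix_vector_mult_linear_continuous_on)
  moreover have "S \<noteq> {}"
    using axis_simplex by (auto simp: S_def)
  moreover have "S \<inter> P = {}"
    using no by (auto simp: S_def P_def unit_simplex_def)
  ultimately obtain a b where aS: "\<forall>x\<in>S. a \<bullet> x < b" and aP: "\<forall>x\<in>P. b < a \<bullet> x"
    using separating_hyperplane_compact_closed[of S P] convex_nonneg_vec closed_nonneg_vec
    unfolding P_def by blast
  have "b < 0"
    using aP[rule_format, of 0] by (simp add: P_def nonneg_vec_def)
  have "0 \<le> a$i" for i
  proof (rule ccontr)
    assume "\<not> 0 \<le> a$i"
    then have "axis i (b / a$i) \<in> P"
      using \<open>b < 0\<close> by (auto simp: P_def nonneg_vec_def axis_def divide_nonpos_neg)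
    moreover have "a \<bullet> axis i (b / a$i) = b"
      using \<open>\<not> 0 \<le> a$i\<close> by (simp add: inner_axis)
    ultimately show False
      using aP by fastforce
  qed
  moreover have "(a v* N)$j < 0" for j
  proof -
    have "(a v* N)$j = a \<bullet> (N *v axis j 1)"
      by (simp add: dot_lmul_matrix[symmetric] inner_axis)
    also have "\<dots> < b"
      using aS axis_simplex by (auto simp: S_def)
    finally show ?thesis
      using \<open>b < 0\<close> by linarith
  qed
  ultimately show ?thesis
    using copositive_lyapunov_perturb[of a N] that by (auto simp: nonneg_vec_def)
qed

lemma metzler_alternative:
  fixes N :: "real^'n^'n"
  assumes "metzler N" "\<not> nonneg_eigenpair N"
  obtains v where "copositive_lyapunov N v"
  using assms metzler_nonneg_eigenpair copositive_lyapunov_if_no_nonneg_image by metis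

lemma det_eq_0_iff_kernel:
  fixes M :: "'a::field^'n^'n"
  shows "det M = 0 \<longleftrightarrow> (\<exists>x. x \<noteq> 0 \<and> M *v x = 0)"
proof -
  have "det M = 0 \<longleftrightarrow> \<not> inj ((*v) M)"
    using det_nz_iff_inj_gen[OF matrix_vector_mul_linear_gen, of M] by auto
  also have "\<dots> \<longleftrightarrow> (\<exists>x. x \<noteq> 0 \<and> M *v x = 0)"
    using vec.linear_inj_iff_eq_0[OF matrix_vector_mul_linear_gen] by blast
  finally show ?thesis .
qed

lemma mat_matrix_vector_mult: "mat s *v w = s *\<^sub>R (w :: real^'n)"
  by (simp add: vec_eq_iff matrix_vector_mult_def mat_def if_distrib[of "\<lambda>a. a * _"] cong: if_cong)

lemma nonneg_eigenpair_charpoly_root: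
  assumes "nonneg_eigenpair A"
  obtains s where "0 \<le> s" "poly (charpoly A) s = 0"
proof -
  obtain w s where "w \<noteq> 0" "0 \<le> s" "A *v w = s *\<^sub>R w"
    using assms by (auto simp: nonneg_eigenpair_def)
  moreover from this have "(mat s - A) *v w = 0"
    by (simp add: matrix_vector_mult_diff_rdistrib mat_matrix_vector_mult)
  ultimately show ?thesis
    using that det_eq_0_iff_kernel[of "mat s - A"] by (auto simp: poly_charpoly)
qed

lemma poly_pos_if_pos_coeffs:
  assumes "pos_coeffs p" "0 \<le> s"
  shows "0 < poly p s"
proof -
  have "poly p s = coeff p 0 + (\<Sum>i\<in>{..degree p} - {0}. coeff p i * s ^ i)"
    by (simp add: poly_altdef sum.remove[of _ 0])
  moreover have "0 \<le> (\<Sum>i\<in>{..degree p} - {0}. coeff p i * s ^ i)"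
    using assms pos_coeffs_nonneg by (intro sum_nonneg mult_nonneg_nonneg) auto
  moreover have "0 < coeff p 0"
    using assms by (simp add: pos_coeffs_def)
  ultimately show ?thesis
    by linarith
qed

lemma no_nonneg_eigenpair_if_pos_coeffs:
  assumes "pos_coeffs (charpoly A)"
  shows "\<not> nonneg_eigenpair A"
  using nonneg_eigenpair_charpoly_root poly_pos_if_pos_coeffs[OF assms] by (metis less_irrefl)

lemma max_weighted_component:
  fixes x :: "'a::real_normed_vector^'n" and v :: "real^'n"
  assumes "x \<noteq> 0" "\<And>i. 0 < v$i"
  obtains j where "x$j \<noteq> 0" "\<And>i. norm (x$i) \<le> norm (x$j) / v$j * v$i"
proof -
  define g where "g i = norm (x$i) / v$i" for i
  have "Max (range g) \<in> range g"
    by (rule Max_in) auto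
  then obtain j where j: "g j = Max (range g)"
    by (metis rangeE)
  have x_le: "norm (x$i) \<le> g j * v$i" for i
  proof -
    have "norm (x$i) = g i * v$i"
      using assms(2)[of i] by (simp add: g_def)
    also have "\<dots> \<le> g j * v$i"
      using Max_ge[of "range g" "g i"] assms(2)[of i] by (simp add: j)
    finally show ?thesis .
  qed
  moreover have "x$j \<noteq> 0"
  proof
    assume "x$j = 0"
    then have "x$i = 0" for i
      using x_le[of i] by (simp add: g_def)
    then show False
      using assms(1) by (simp add: vec_eq_iff)
  qed
  ultimately show ?thesis
    using that by (simp add: g_def)
qed

text \<open>A Gershgorin-type argument along the column \<open>j\<close> of a left eigenvector \<open>x\<close> at which
  \<open>\<bar>x\<^sub>i\<bar> / v\<^sub>i\<close> is maximal gives \<open>\<bar>z - N\<^sub>j\<^sub>j\<bar> < - N\<^sub>j\<^sub>j\<close> for every eigenvalue \<open>z\<close>.\<close>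

lemma charpoly_roots_in_left_half_plane:
  fixes N :: "real^'n^'n"
  assumes met: "metzler N" and v: "copositive_lyapunov N v" and z: "complex_root (charpoly N) z"
  shows "Re z < 0"
proof -
  have v_pos: "0 < v$i" and v_neg: "(v v* N)$i < 0" for i
    using v by (auto simp: copositive_lyapunov_def)
  define M where "M = mat z - map_matrix complex_of_real N"
  have "det (transpose M) = 0"
    using z by (simp add: M_def complex_root_def poly_map_poly_of_real_charpoly)
  then obtain x where "x \<noteq> 0" and "transpose M *v x = 0"
    using det_eq_0_iff_kernel by blast
  then have x: "x v* M = 0"
    by simp
  obtain j where "x$j \<noteq> 0" and x_le: "\<And>i. cmod (x$i) \<le> cmod (x$j) / v$j * v$i"
    using max_weighted_component[OF \<open>x \<noteq> 0\<close>] v_pos by blast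
  define g where "g = cmod (x$j) / v$j"
  have "(\<Sum>i\<in>UNIV. ((if i = j then z else 0) - of_real (N$i$j)) * x$i) = 0"
    using x by (simp add: M_def vec_eq_iff vector_matrix_mult_def mat_def mult.commute)
  then have col: "(z - of_real (N$j$j)) * x$j = (\<Sum>i\<in>UNIV - {j}. of_real (N$i$j) * x$i)"
    by (simp add: sum.remove[of _ j] left_diff_distrib sum_subtractf algebra_simps
        del: sum.insert_remove)
  have "cmod (z - of_real (N$j$j)) * cmod (x$j) \<le> (\<Sum>i\<in>UNIV - {j}. cmod (of_real (N$i$j) * x$i))"
    unfolding norm_mult[symmetric] col by (rule norm_sum)
  also have "\<dots> \<le> (\<Sum>i\<in>UNIV - {j}. N$i$j * (g * v$i))"
  proof (rule sum_mono)
    fix i assume "i \<in> UNIV - {j}"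
    then have "0 \<le> N$i$j"
      using met by (auto simp: metzler_def)
    then show "cmod (of_real (N$i$j) * x$i) \<le> N$i$j * (g * v$i)"
      using x_le[of i, folded g_def] by (simp add: norm_mult mult_left_mono)
  qed
  also have "\<dots> = g * ((v v* N)$j - N$j$j * v$j)"
    by (simp add: vector_matrix_mult_def sum.remove[of _ j] sum_distrib_left algebra_simps)
  also have "\<dots> < g * (- N$j$j * v$j)"
    using v_neg[of j] \<open>x$j \<noteq> 0\<close> v_pos[of j] by (intro mult_strict_left_mono) (auto simp: g_def)
  also have "\<dots> = - N$j$j * cmod (x$j)"
    using v_pos[of j] by (simp add: g_def)
  finally have "cmod (z - of_real (N$j$j)) < - N$j$j"
    by (rule mult_right_less_imp_less) simp
  moreover have "Re z - N$j$j \<le> cmod (z - of_real (N$j$j))"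
    using complex_Re_le_cmod[of "z - of_real (N$j$j)"] by simp
  ultimately show ?thesis
    by linarith
qed

lemma pos_coeffs_charpoly_if_copositive_lyapunov:
  fixes A :: "real^'n^'n"
  assumes "metzler A" "copositive_lyapunov A v"
  shows "pos_coeffs (charpoly A)"
  using pos_coeffs_if_roots_in_left_half_plane charpoly_roots_in_left_half_plane[OF assms]
  by (simp add: lead_coeff_charpoly)

section \<open>Time scales unbounded above\<close>

lemma le_0_if_le_eps_mult:
  fixes a c :: real
  assumes "\<And>\<epsilon>. 0 < \<epsilon> \<Longrightarrow> a \<le> \<epsilon> * c" "0 \<le> c"
  shows "a \<le> 0"
proof (rule field_le_epsilon)
  fix e :: real assume "0 < e"
  then have "a \<le> e / (c + 1) * c"
    using assms by (intro assms(1)) (simp add: add_nonneg_pos)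
  also have "\<dots> \<le> 0 + e"
    using \<open>0 < e\<close> assms(2) by (simp add: field_simps)
  finally show "a \<le> 0 + e" .
qed

lemma sigma_ts_restrict:
  assumes "t0 \<le> t"
  shows "sigma_ts {s\<in>T. t0 \<le> s} t = sigma_ts T t"
proof -
  have "{s\<in>{s\<in>T. t0 \<le> s}. t < s} = {s\<in>T. t < s}"
    using assms by auto
  then show ?thesis
    unfolding sigma_ts_def by (simp only:)
qed

locale unbounded_time_scale =
  fixes T :: "real set"
  assumes closed_T: "closed T" and unbounded: "\<forall>r. \<exists>t\<in>T. r < t"
begin

lemma sigma_ts_eq_Inf: "sigma_ts T t = Inf {s\<in>T. t < s}"
  using unbounded unfolding sigma_ts_def by auto

lemma sigma_ts_le: "s \<in> T \<Longrightarrow> t < s \<Longrightarrow> sigma_ts T t \<le> s"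
  unfolding sigma_ts_eq_Inf by (intro cInf_lower) (auto intro: bdd_belowI[of _ t])

lemma sigma_ts_ge: "t \<le> sigma_ts T t"
  unfolding sigma_ts_eq_Inf using unbounded by (intro cInf_greatest) auto

lemma sigma_ts_in:
  assumes "t \<in> T"
  shows "sigma_ts T t \<in> T"
proof -
  have "Inf {s\<in>T. t < s} \<in> closure {s\<in>T. t < s}"
    using unbounded by (intro closure_contains_Inf) (auto intro: bdd_belowI[of _ t])
  also have "\<dots> \<subseteq> T"
    using closed_T by (intro closure_minimal) auto
  finally show ?thesis
    by (simp add: sigma_ts_eq_Inf)
qed

lemma right_dense_approach:
  assumes "sigma_ts T t = t" "0 < d"
  obtains u where "u \<in> T" "t < u" "u < t + d"
proof -
  have "Inf {s\<in>T. t < s} < t + d"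
    using assms by (simp add: sigma_ts_eq_Inf)
  then show ?thesis
    using that unbounded by (subst (asm) cInf_less_iff) (auto intro: bdd_belowI[of _ t])
qed

lemma left_scattered_predecessor:
  assumes "t0 \<in> T" "m \<in> T" "t0 < m" and gap: "0 < d" "\<forall>u\<in>T. \<not> (m - d < u \<and> u < m)"
  obtains \<rho> where "\<rho> \<in> T" "t0 \<le> \<rho>" "\<rho> < m" "sigma_ts T \<rho> = m"
proof -
  define L where "L = {u\<in>T. t0 \<le> u \<and> u < m}"
  have "L = T \<inter> {t0..m - d}"
    using gap by (auto simp: L_def)
  then have "closed L"
    using closed_T by auto
  moreover have "L \<noteq> {}" "bdd_above L"
    using assms by (auto simp: L_def intro: bdd_aboveI[of _ m])
  ultimately have "Sup L \<in> L"
    by (rule closed_contains_Sup[rotated -1])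
  then have \<rho>: "Sup L \<in> T" "t0 \<le> Sup L" "Sup L < m"
    by (auto simp: L_def)
  have "m \<le> sigma_ts T (Sup L)"
    unfolding sigma_ts_eq_Inf
  proof (rule cInf_greatest)
    show "{s \<in> T. Sup L < s} \<noteq> {}"
      using \<rho> assms by auto
    fix s assume s: "s \<in> {s \<in> T. Sup L < s}"
    show "m \<le> s"
    proof (rule ccontr)
      assume "\<not> m \<le> s"
      then have "s \<le> Sup L"
        using s \<rho> \<open>bdd_above L\<close> by (intro cSup_upper) (auto simp: L_def)
      then show False
        using s by simp
    qed
  qed
  then show ?thesis
    using that \<rho> sigma_ts_le[OF \<open>m \<in> T\<close> \<rho>(3)] by simp
qed

end

section \<open>Generalised monomials\<close>

text \<open>\<open>ts_floor T t0 \<tau>\<close> is the last point of \<open>T\<close> in \<open>[t0, \<tau>]\<close>. The delta integral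
  \<open>\<integral>\<^sub>a\<^sup>b f(\<tau>) \<Delta>\<tau>\<close> of a function on \<open>T\<close> is the ordinary integral of its piecewise constant extension
  \<open>f \<circ> ts_floor T t0\<close>, so the monomials below are the time scale monomials
  \<open>h\<^sub>k\<^sub>+\<^sub>1(t, t0) = \<integral>\<^sub>t\<^sub>0\<^sup>t h\<^sub>k(\<tau>, t0) \<Delta>\<tau>\<close>.\<close>

definition ts_floor :: "real set \<Rightarrow> real \<Rightarrow> real \<Rightarrow> real" where
  "ts_floor T t0 \<tau> = Sup {u\<in>T. t0 \<le> u \<and> u \<le> \<tau>}"

primrec ts_monomial :: "real set \<Rightarrow> real \<Rightarrow> nat \<Rightarrow> real \<Rightarrow> real" where
  "ts_monomial T t0 0 t = 1"
| "ts_monomial T t0 (Suc k) t = integral {t0..t} (\<lambda>\<tau>. ts_monomial T t0 k (ts_floor T t0 \<tau>))"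

definition ts_exp_series :: "real set \<Rightarrow> real \<Rightarrow> real^'n^'n \<Rightarrow> real^'n \<Rightarrow> real \<Rightarrow> real^'n" where
  "ts_exp_series T t0 A x0 t = (\<Sum>k. ts_monomial T t0 k t *\<^sub>R ((*v) A ^^ k) x0)"

lemma norm_matrix_power_apply_le:
  fixes A :: "real^'n^'n"
  assumes "\<And>v. norm (A *v v) \<le> B * norm v" "0 \<le> B"
  shows "norm (((*v) A ^^ k) x) \<le> B^k * norm x"
proof (induction k)
  case (Suc k)
  then have "B * norm (((*v) A ^^ k) x) \<le> B * (B^k * norm x)"
    using assms(2) by (intro mult_left_mono)
  then show ?case
    using assms(1)[of "((*v) A ^^ k) x"] by simp
qed simp

lemma matrix_vector_mult_norm_bound:
  fixes A :: "real^'n^'m"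
  obtains B where "0 < B" "\<And>v. norm (A *v v) \<le> B * norm v"
  using bounded_linear.pos_bounded[OF matrix_vector_mul_bounded_linear, of A]
  by (auto simp: mult.commute)

locale forward_time_scale = unbounded_time_scale +
  fixes t0 :: real
  assumes t0_in_T: "t0 \<in> T"
begin

abbreviation "h \<equiv> ts_monomial T t0"
abbreviation "r \<equiv> ts_floor T t0"

lemma ts_floor_upper: "u \<in> T \<Longrightarrow> t0 \<le> u \<Longrightarrow> u \<le> \<tau> \<Longrightarrow> u \<le> r \<tau>"
  unfolding ts_floor_def by (intro cSup_upper) (auto intro: bdd_aboveI[of _ \<tau>])

lemma ts_floor_bounds:
  assumes "t0 \<le> \<tau>"
  shows "r \<tau> \<in> T" "t0 \<le> r \<tau>" "r \<tau> \<le> \<tau>"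
proof -
  let ?S = "{u\<in>T. t0 \<le> u \<and> u \<le> \<tau>}"
  have "?S = T \<inter> {t0..\<tau>}"
    by auto
  then have "closed ?S"
    using closed_T by auto
  moreover have "?S \<noteq> {}" "bdd_above ?S"
    using assms t0_in_T by (auto intro: bdd_aboveI[of _ \<tau>])
  ultimately have "Sup ?S \<in> ?S"
    by (rule closed_contains_Sup[rotated -1])
  then show "r \<tau> \<in> T" "t0 \<le> r \<tau>" "r \<tau> \<le> \<tau>"
    unfolding ts_floor_def by auto
qed

lemma ts_floor_eq: "u \<in> T \<Longrightarrow> t0 \<le> u \<Longrightarrow> r u = u"
  using ts_floor_bounds[of u] ts_floor_upper[of u u] by simp

lemma ts_floor_mono: "t0 \<le> a \<Longrightarrow> a \<le> b \<Longrightarrow> r a \<le> r b"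
  using ts_floor_bounds[of a] by (intro ts_floor_upper) (auto simp: t0_in_T)

lemma ts_floor_gap:
  assumes "t \<in> T" "t0 \<le> t" "t \<le> \<tau>" "\<tau> < sigma_ts T t"
  shows "r \<tau> = t"
proof -
  have "t \<le> r \<tau>"
    using assms by (intro ts_floor_upper) auto
  moreover have "\<not> t < r \<tau>"
  proof
    assume "t < r \<tau>"
    then have "sigma_ts T t \<le> r \<tau>"
      using sigma_ts_le ts_floor_bounds(1)[of \<tau>] assms by auto
    then show False
      using ts_floor_bounds(3)[of \<tau>] assms by auto
  qed
  ultimately show ?thesis
    by simp
qed

lemma ts_monomial_mono_nonneg: "mono_on {t0..} (h k) \<and> (\<forall>t\<ge>t0. 0 \<le> h k t)"
proof (induction k)
  case 0
  then show ?case
    by (auto intro: mono_onI)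
next
  case (Suc k)
  have integrable: "(\<lambda>\<tau>. h k (r \<tau>)) integrable_on {a..b}" if "t0 \<le> a" for a b
  proof (rule integrable_on_mono_on, rule mono_onI)
    fix x y assume "x \<in> {a..b}" "y \<in> {a..b}" "x \<le> y"
    then show "h k (r x) \<le> h k (r y)"
      using Suc.IH ts_floor_bounds[of x] ts_floor_bounds[of y] ts_floor_mono[of x y] that
      by (intro mono_onD[of "{t0..}" "h k"]) auto
  qed
  have diff: "0 \<le> h (Suc k) b - h (Suc k) a" if "t0 \<le> a" "a \<le> b" for a b
  proof -
    have "integral {t0..a} (\<lambda>\<tau>. h k (r \<tau>)) + integral {a..b} (\<lambda>\<tau>. h k (r \<tau>)) =
        integral {t0..b} (\<lambda>\<tau>. h k (r \<tau>))"
      using that integrable[of t0] by (intro Henstock_Kurzweil_Integration.integral_combine) auto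
    moreover have "0 \<le> integral {a..b} (\<lambda>\<tau>. h k (r \<tau>))"
      using Suc.IH ts_floor_bounds that by (intro integral_nonneg integrable) auto
    ultimately show ?thesis
      by simp
  qed
  have "mono_on {t0..} (h (Suc k))"
    by (rule mono_onI) (use diff in force)
  moreover have "0 \<le> h (Suc k) t" if "t0 \<le> t" for t
    using diff[of t0 t] that by simp
  ultimately show ?case
    by blast
qed

lemma ts_monomial_mono: "t0 \<le> a \<Longrightarrow> a \<le> b \<Longrightarrow> h k a \<le> h k b"
  using ts_monomial_mono_nonneg[of k] by (auto intro: mono_onD)

lemma ts_monomial_nonneg: "t0 \<le> t \<Longrightarrow> 0 \<le> h k t"
  using ts_monomial_mono_nonneg[of k] by auto

lemma ts_monomial_integrable: "t0 \<le> a \<Longrightarrow> (\<lambda>\<tau>. h k (r \<tau>)) integrable_on {a..b}"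
proof (rule integrable_on_mono_on, rule mono_onI)
  fix x y assume "t0 \<le> a" "x \<in> {a..b}" "y \<in> {a..b}" "x \<le> y"
  then show "h k (r x) \<le> h k (r y)"
    using ts_floor_bounds[of x] ts_floor_mono[of x y] by (intro ts_monomial_mono) auto
qed

lemma ts_monomial_Suc_diff:
  assumes "t0 \<le> a" "a \<le> b"
  shows "h (Suc k) b - h (Suc k) a = integral {a..b} (\<lambda>\<tau>. h k (r \<tau>))"
  using assms ts_monomial_integrable[of t0 k b]
    Henstock_Kurzweil_Integration.integral_combine[of t0 a b "\<lambda>\<tau>. h k (r \<tau>)"]
  by simp

lemma ts_monomial_Suc_diff_bounds:
  assumes "t0 \<le> a" "a \<le> b"
  shows "(b - a) * h k (r a) \<le> h (Suc k) b - h (Suc k) a"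
    and "h (Suc k) b - h (Suc k) a \<le> (b - a) * h k (r b)"
proof -
  have bounds: "h k (r a) \<le> h k (r \<tau>)" "h k (r \<tau>) \<le> h k (r b)" if "\<tau> \<in> {a..b}" for \<tau>
    using that assms ts_floor_bounds ts_floor_mono by (auto intro!: ts_monomial_mono)
  show "(b - a) * h k (r a) \<le> h (Suc k) b - h (Suc k) a"
    unfolding ts_monomial_Suc_diff[OF assms]
    using integral_le[of "\<lambda>_. h k (r a)" "{a..b}" "\<lambda>\<tau>. h k (r \<tau>)"] bounds(1) assms
    by (simp add: ts_monomial_integrable integrable_const_ivl)
  show "h (Suc k) b - h (Suc k) a \<le> (b - a) * h k (r b)"
    unfolding ts_monomial_Suc_diff[OF assms]
    using integral_le[of "\<lambda>\<tau>. h k (r \<tau>)" "{a..b}" "\<lambda>_. h k (r b)"] bounds(2) assms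
    by (simp add: ts_monomial_integrable integrable_const_ivl)
qed

lemma ts_monomial_Suc_sigma:
  assumes "t \<in> T" "t0 \<le> t"
  shows "h (Suc k) (sigma_ts T t) - h (Suc k) t = (sigma_ts T t - t) * h k t"
proof -
  let ?s = "sigma_ts T t"
  have "integral {t..?s} (\<lambda>\<tau>. h k (r \<tau>)) = integral {t..?s} (\<lambda>\<tau>. h k t)"
    using ts_floor_gap[OF assms] by (intro integral_spike[of "{?s}"]) auto
  then show ?thesis
    using ts_monomial_Suc_diff[OF assms(2) sigma_ts_ge] sigma_ts_ge[of t] by simp
qed

lemma ts_monomial_le_power: "t0 \<le> t \<Longrightarrow> h k t \<le> (t - t0)^k / fact k"
proof (induction k arbitrary: t)
  case 0
  then show ?case
    by simp
next
  case (Suc k)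
  have power_integral: "((\<lambda>\<tau>. (\<tau> - t0)^k / fact k) has_integral (t - t0)^Suc k / fact (Suc k)) {t0..t}"
  proof -
    have "((\<lambda>\<tau>. (\<tau> - t0)^Suc k / fact (Suc k)) has_real_derivative
        (real (Suc k) * (x - t0)^k * 1 / fact (Suc k))) (at x within {t0..t})" for x
      by (intro derivative_eq_intros) auto
    moreover have "real (Suc k) * (x - t0)^k * 1 / fact (Suc k) = (x - t0)^k / fact k" for x
    proof -
      have "(fact (Suc k) :: real) = real (Suc k) * fact k"
        by (rule fact_Suc)
      then show ?thesis
        by (simp del: of_nat_Suc)
    qed
    ultimately show ?thesis
      using fundamental_theorem_of_calculus[OF Suc.prems, of "\<lambda>\<tau>. (\<tau> - t0)^Suc k / fact (Suc k)"]
      by (simp add: has_real_derivative_iff_has_vector_derivative)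
  qed
  have "h k (r \<tau>) \<le> (\<tau> - t0)^k / fact k" if "\<tau> \<in> {t0..t}" for \<tau>
    using Suc.IH[of \<tau>] ts_floor_bounds[of \<tau>] ts_monomial_mono[of "r \<tau>" \<tau> k] that by auto
  then have "h (Suc k) t \<le> integral {t0..t} (\<lambda>\<tau>. (\<tau> - t0)^k / fact k)"
    unfolding ts_monomial.simps
    by (intro integral_le ts_monomial_integrable has_integral_integrable[OF power_integral]) auto
  also have "\<dots> = (t - t0)^Suc k / fact (Suc k)"
    using power_integral by (rule integral_unique)
  finally show ?case .
qed

lemma ts_monomial_lipschitz:
  assumes "t0 \<le> a" "t0 \<le> b" "a \<le> t0 + R" "b \<le> t0 + R"
  shows "\<bar>h k b - h k a\<bar> \<le> \<bar>b - a\<bar> * (R^(k - 1) / fact (k - 1))"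
proof (cases k)
  case 0
  then show ?thesis
    by simp
next
  case (Suc j)
  have "h (Suc j) y - h (Suc j) x \<le> (y - x) * (R^j / fact j)"
    if "t0 \<le> x" "x \<le> y" "y \<le> t0 + R" for x y
  proof -
    have "h j (r y) \<le> h j y"
      using ts_floor_bounds[of y] that by (intro ts_monomial_mono) auto
    also have "\<dots> \<le> (y - t0)^j / fact j"
      using ts_monomial_le_power that by auto
    also have "\<dots> \<le> R^j / fact j"
      using that by (intro divide_right_mono power_mono) auto
    finally have "(y - x) * h j (r y) \<le> (y - x) * (R^j / fact j)"
      using that by (intro mult_left_mono) auto
    then show ?thesis
      using ts_monomial_Suc_diff_bounds(2)[of x y j] that by linarith
  qed
  then show ?thesis
    using assms ts_monomial_mono[of a b k] ts_monomial_mono[of b a k] Suc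
    by (cases "a \<le> b") (auto simp: abs_if)
qed

lemma ts_monomial_Suc_error:
  assumes t: "t \<in> T" "t0 \<le> t" and s: "s \<in> T" "t0 \<le> s"
  shows "\<bar>h (Suc k) (sigma_ts T t) - h (Suc k) s - (sigma_ts T t - s) * h k t\<bar>
    \<le> \<bar>t - s\<bar> * \<bar>h k t - h k s\<bar>"
proof -
  have "h (Suc k) (sigma_ts T t) - h (Suc k) s - (sigma_ts T t - s) * h k t
      = h (Suc k) t - h (Suc k) s - (t - s) * h k t"
    using ts_monomial_Suc_sigma[OF t, of k] by (simp add: algebra_simps)
  moreover have "\<bar>h (Suc k) t - h (Suc k) s - (t - s) * h k t\<bar> \<le> \<bar>t - s\<bar> * \<bar>h k t - h k s\<bar>"
  proof (cases "s \<le> t")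
    case True
    then show ?thesis
      using ts_monomial_Suc_diff_bounds[of s t k] ts_monomial_mono[of s t k] s t
      by (auto simp: ts_floor_eq abs_if algebra_simps)
  next
    case False
    then show ?thesis
      using ts_monomial_Suc_diff_bounds[of t s k] ts_monomial_mono[of t s k] s t
      by (auto simp: ts_floor_eq abs_if algebra_simps)
  qed
  ultimately show ?thesis
    by simp
qed

lemma ts_monomial_Suc_quadratic_error:
  assumes t: "t \<in> T" "t0 \<le> t" "t \<le> t0 + R" and s: "s \<in> T" "t0 \<le> s" "s \<le> t0 + R"
  shows "\<bar>h (Suc k) (sigma_ts T t) - h (Suc k) s - (sigma_ts T t - s) * h k t\<bar>
    \<le> (t - s)^2 * (R^(k - 1) / fact (k - 1))"
proof -
  have "\<bar>h (Suc k) (sigma_ts T t) - h (Suc k) s - (sigma_ts T t - s) * h k t\<bar>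
      \<le> \<bar>t - s\<bar> * \<bar>h k t - h k s\<bar>"
    by (rule ts_monomial_Suc_error[OF t(1,2) s(1,2)])
  also have "\<dots> \<le> \<bar>t - s\<bar> * (\<bar>t - s\<bar> * (R^(k - 1) / fact (k - 1)))"
    using ts_monomial_lipschitz[of s t R k] s t by (intro mult_left_mono) auto
  finally show ?thesis
    by (simp add: power2_eq_square mult.assoc)
qed

text \<open>The delta derivative reduced to a quadratic error bound near \<open>t\<close>: points \<open>s\<close> close
  to a right-scattered \<open>t\<close> satisfy \<open>s \<le> t\<close>, so that \<open>\<bar>t - s\<bar> \<le> \<bar>\<sigma> t - s\<bar>\<close>.\<close>

lemma has_delta_derivative_if_quadratic_error:
  fixes x :: "real \<Rightarrow> 'a::real_normed_vector"
  assumes "0 \<le> C" "0 < d"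
    and err: "\<And>s. s \<in> T \<Longrightarrow> t0 \<le> s \<Longrightarrow> \<bar>s - t\<bar> < d \<Longrightarrow>
      norm (x (sigma_ts T t) - x s - (sigma_ts T t - s) *\<^sub>R D) \<le> (t - s)^2 * C"
    and "t0 \<le> t"
  shows "has_delta_derivative {s\<in>T. t0 \<le> s} x t D"
  unfolding has_delta_derivative_def sigma_ts_restrict[OF \<open>t0 \<le> t\<close>]
proof (intro allI impI)
  fix \<epsilon> :: real assume "0 < \<epsilon>"
  let ?s = "sigma_ts T t"
  define \<delta> where "\<delta> = min d (min (if t < ?s then ?s - t else 1) (\<epsilon> / (C + 1)))"
  have "0 < \<delta>"
    using \<open>0 < \<epsilon>\<close> assms by (simp add: \<delta>_def)
  moreover have "norm (x ?s - x s - (?s - s) *\<^sub>R D) \<le> \<epsilon> * \<bar>?s - s\<bar>"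
    if s: "s \<in> T" "t0 \<le> s" "\<bar>s - t\<bar> < \<delta>" for s
  proof -
    have "s \<le> t \<or> ?s = t"
      using sigma_ts_le[of s t] sigma_ts_ge[of t] s by (force simp: \<delta>_def split: if_splits)
    then have "\<bar>t - s\<bar> \<le> \<bar>?s - s\<bar>"
      using sigma_ts_ge[of t] by auto
    moreover have "\<bar>t - s\<bar> * C \<le> \<epsilon>"
    proof -
      have "\<bar>t - s\<bar> * C \<le> \<epsilon> / (C + 1) * C"
        using s \<open>0 \<le> C\<close> by (intro mult_right_mono) (auto simp: \<delta>_def abs_minus_commute)
      also have "\<dots> \<le> \<epsilon>"
        using \<open>0 < \<epsilon>\<close> \<open>0 \<le> C\<close> by (simp add: field_simps)
      finally show ?thesis .
    qed
    ultimately have "\<bar>t - s\<bar> * (\<bar>t - s\<bar> * C) \<le> \<bar>?s - s\<bar> * \<epsilon>"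
      using \<open>0 \<le> C\<close> by (intro mult_mono) auto
    moreover have "(t - s)^2 * C = \<bar>t - s\<bar> * (\<bar>t - s\<bar> * C)"
      by (simp add: power2_eq_square mult.assoc[symmetric])
    ultimately have "(t - s)^2 * C \<le> \<epsilon> * \<bar>?s - s\<bar>"
      by (simp only: mult.commute)
    then show ?thesis
      using err[OF s(1,2)] s(3) by (simp add: \<delta>_def)
  qed
  ultimately show "\<exists>\<delta>>0. \<forall>s\<in>{s\<in>T. t0 \<le> s}. \<bar>s - t\<bar> < \<delta> \<longrightarrow>
      norm (x ?s - x s - (?s - s) *\<^sub>R D) \<le> \<epsilon> * \<bar>?s - s\<bar>"
    by auto
qed

lemma ts_exp_series_summable:
  fixes A :: "real^'n^'n"
  assumes "t0 \<le> t"
  shows "summable (\<lambda>k. norm (h k t *\<^sub>R ((*v) A ^^ k) x0))"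
proof -
  obtain B where B: "0 < B" "\<And>v. norm (A *v v) \<le> B * norm v"
    using matrix_vector_mult_norm_bound by blast
  have "norm (h k t *\<^sub>R ((*v) A ^^ k) x0) \<le> norm x0 * (inverse (fact k) * (B * (t - t0))^k)" for k
  proof -
    have "norm (h k t *\<^sub>R ((*v) A ^^ k) x0) = h k t * norm (((*v) A ^^ k) x0)"
      using ts_monomial_nonneg[OF assms] by simp
    also have "\<dots> \<le> ((t - t0)^k / fact k) * (B^k * norm x0)"
      using ts_monomial_le_power[OF assms] ts_monomial_nonneg[OF assms] B assms
      by (intro mult_mono norm_matrix_power_apply_le) auto
    finally show ?thesis
      by (simp add: power_mult_distrib divide_inverse mult_ac)
  qed
  then show ?thesis
    by (intro summable_comparison_test'[OF summable_mult[OF summable_exp]]) auto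
qed

lemma ts_exp_series_sums:
  fixes A :: "real^'n^'n"
  assumes "t0 \<le> t"
  shows "(\<lambda>k. h k t *\<^sub>R ((*v) A ^^ k) x0) sums ts_exp_series T t0 A x0 t"
  unfolding ts_exp_series_def
  using summable_norm_cancel[OF ts_exp_series_summable[OF assms]] by (rule summable_sums)

lemma ts_exp_series_t0: "ts_exp_series T t0 A x0 t0 = x0"
proof -
  have "(\<lambda>k. h k t0 *\<^sub>R ((*v) A ^^ k) x0) = (\<lambda>k. if k = 0 then x0 else 0)"
    by (rule ext) (case_tac k, auto)
  then show ?thesis
    using sums_unique[OF sums_single[of 0 "\<lambda>_. x0"]] by (simp add: ts_exp_series_def)
qed

lemma ts_exp_series_matrix_sums:
  fixes A :: "real^'n^'n"
  assumes "t0 \<le> t"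
  shows "(\<lambda>k. h k t *\<^sub>R ((*v) A ^^ Suc k) x0) sums (A *v ts_exp_series T t0 A x0 t)"
  using bounded_linear.sums[OF matrix_vector_mul_bounded_linear ts_exp_series_sums[OF assms], of A]
  by (simp add: matrix_vector_mult_scaleR)

lemma ts_exp_series_quadratic_error:
  fixes A :: "real^'n^'n"
  assumes "0 \<le> R"
  obtains C where "0 \<le> C"
    "\<And>s t. t \<in> T \<Longrightarrow> s \<in> T \<Longrightarrow> t0 \<le> t \<Longrightarrow> t0 \<le> s \<Longrightarrow> t \<le> t0 + R \<Longrightarrow> s \<le> t0 + R \<Longrightarrow>
      norm (ts_exp_series T t0 A x0 (sigma_ts T t) - ts_exp_series T t0 A x0 s
        - (sigma_ts T t - s) *\<^sub>R (A *v ts_exp_series T t0 A x0 t)) \<le> (t - s)^2 * C"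
proof -
  obtain B where B: "0 < B" "\<And>v. norm (A *v v) \<le> B * norm v"
    using matrix_vector_mult_norm_bound by blast
  define c where "c k = R^(k - 1) / fact (k - 1) * (B^Suc k * norm x0)" for k
  have "summable (\<lambda>j. (B^2 * norm x0) * (inverse (fact j) * (R * B)^j))"
    by (rule summable_mult[OF summable_exp])
  then have "summable (\<lambda>j. c (Suc j))"
    by (simp add: c_def power_mult_distrib divide_inverse power2_eq_square mult_ac)
  then have c_summable: "summable c"
    by (rule summable_Suc_iff[THEN iffD1])
  show ?thesis
  proof
    fix s t assume t: "t \<in> T" "t0 \<le> t" "t \<le> t0 + R" and s: "s \<in> T" "t0 \<le> s" "s \<le> t0 + R"
    let ?x = "ts_exp_series T t0 A x0" and ?\<sigma> = "sigma_ts T t"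
    let ?e = "\<lambda>k. (h (Suc k) ?\<sigma> - h (Suc k) s - (?\<sigma> - s) * h k t) *\<^sub>R ((*v) A ^^ Suc k) x0"
    have "(\<lambda>k. (h k ?\<sigma> - h k s) *\<^sub>R ((*v) A ^^ k) x0) sums (?x ?\<sigma> - ?x s)"
      unfolding scaleR_left_diff_distrib
      using t s sigma_ts_ge[of t] by (intro sums_diff ts_exp_series_sums) auto
    then have "(\<lambda>k. (h (Suc k) ?\<sigma> - h (Suc k) s) *\<^sub>R ((*v) A ^^ Suc k) x0) sums (?x ?\<sigma> - ?x s)"
      by (subst sums_Suc_iff) simp
    moreover have "(\<lambda>k. ((?\<sigma> - s) * h k t) *\<^sub>R ((*v) A ^^ Suc k) x0) sums ((?\<sigma> - s) *\<^sub>R (A *v ?x t))"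
      using sums_scaleR_right[OF ts_exp_series_matrix_sums[OF t(2), of A x0], of "?\<sigma> - s"] by simp
    ultimately have e_sums: "?e sums (?x ?\<sigma> - ?x s - (?\<sigma> - s) *\<^sub>R (A *v ?x t))"
      unfolding scaleR_left_diff_distrib[of _ _ "((*v) A ^^ Suc _) x0"] by (rule sums_diff)
    have e_bound: "norm (?e k) \<le> (t - s)^2 * c k" for k
    proof -
      have "\<bar>h (Suc k) ?\<sigma> - h (Suc k) s - (?\<sigma> - s) * h k t\<bar>
          \<le> (t - s)^2 * (R^(k - 1) / fact (k - 1))"
        using ts_monomial_Suc_quadratic_error[OF t s] .
      moreover have "norm (((*v) A ^^ Suc k) x0) \<le> B^Suc k * norm x0"
        using B by (intro norm_matrix_power_apply_le) auto
      moreover have "0 \<le> (t - s)^2 * (R^(k - 1) / fact (k - 1))"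
        using t by simp
      ultimately have "\<bar>h (Suc k) ?\<sigma> - h (Suc k) s - (?\<sigma> - s) * h k t\<bar> * norm (((*v) A ^^ Suc k) x0)
          \<le> (t - s)^2 * (R^(k - 1) / fact (k - 1)) * (B^Suc k * norm x0)"
        by (intro mult_mono) auto
      then show ?thesis
        by (simp only: norm_scaleR c_def mult.assoc)
    qed
    have "norm (?x ?\<sigma> - ?x s - (?\<sigma> - s) *\<^sub>R (A *v ?x t)) = norm (suminf ?e)"
      using sums_unique[OF e_sums] by simp
    also have "\<dots> \<le> (\<Sum>k. (t - s)^2 * c k)"
      by (rule norm_suminf_le[OF e_bound summable_mult[OF c_summable]])
    also have "\<dots> = (t - s)^2 * suminf c"
      by (rule suminf_mult[OF c_summable])
    finally show "norm (?x ?\<sigma> - ?x s - (?\<sigma> - s) *\<^sub>R (A *v ?x t)) \<le> (t - s)^2 * suminf c" .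
  next
    show "0 \<le> suminf c"
    proof (rule suminf_nonneg[OF c_summable])
      show "0 \<le> c k" for k
        using assms B(1) unfolding c_def by simp
    qed
  qed
qed

lemma forward_solution_ts_exp_series:
  fixes A :: "real^'n^'n"
  shows "forward_solution T A t0 x0 (ts_exp_series T t0 A x0)"
proof -
  have "has_delta_derivative {s\<in>T. t0 \<le> s} (ts_exp_series T t0 A x0) t (A *v ts_exp_series T t0 A x0 t)"
    if t: "t \<in> T" "t0 \<le> t" for t
  proof -
    obtain C where "0 \<le> C" and C: "\<And>s t'. t' \<in> T \<Longrightarrow> s \<in> T \<Longrightarrow> t0 \<le> t' \<Longrightarrow> t0 \<le> s \<Longrightarrow>
        t' \<le> t0 + (t - t0 + 1) \<Longrightarrow> s \<le> t0 + (t - t0 + 1) \<Longrightarrow>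
        norm (ts_exp_series T t0 A x0 (sigma_ts T t') - ts_exp_series T t0 A x0 s
          - (sigma_ts T t' - s) *\<^sub>R (A *v ts_exp_series T t0 A x0 t')) \<le> (t' - s)^2 * C"
      using ts_exp_series_quadratic_error[of "t - t0 + 1" A x0] t by auto
    show ?thesis
      using C[OF t(1)] t by (intro has_delta_derivative_if_quadratic_error[OF \<open>0 \<le> C\<close> zero_less_one])
        auto
  qed
  then show ?thesis
    unfolding forward_solution_def using ts_exp_series_t0 by blast
qed

lemma has_delta_derivativeD:
  assumes "has_delta_derivative {s\<in>T. t0 \<le> s} x t D" "t0 \<le> t" "0 < \<epsilon>"
  obtains \<delta> where "0 < \<delta>" "\<And>s. s \<in> T \<Longrightarrow> t0 \<le> s \<Longrightarrow> \<bar>s - t\<bar> < \<delta> \<Longrightarrow>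
    norm (x (sigma_ts T t) - x s - (sigma_ts T t - s) *\<^sub>R D) \<le> \<epsilon> * \<bar>sigma_ts T t - s\<bar>"
  using assms unfolding has_delta_derivative_def sigma_ts_restrict[OF assms(2)] by blast

lemma has_delta_derivative_right_scattered:
  fixes x :: "real \<Rightarrow> 'a::real_normed_vector"
  assumes "has_delta_derivative {s\<in>T. t0 \<le> s} x t D" "t \<in> T" "t0 \<le> t"
  shows "x (sigma_ts T t) = x t + (sigma_ts T t - t) *\<^sub>R D"
proof -
  have "norm (x (sigma_ts T t) - x t - (sigma_ts T t - t) *\<^sub>R D) \<le> \<epsilon> * \<bar>sigma_ts T t - t\<bar>"
    if eps: "0 < \<epsilon>" for \<epsilon>
  proof -
    obtain \<delta> where "0 < \<delta>" and "\<And>s. s \<in> T \<Longrightarrow> t0 \<le> s \<Longrightarrow> \<bar>s - t\<bar> < \<delta> \<Longrightarrow>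
        norm (x (sigma_ts T t) - x s - (sigma_ts T t - s) *\<^sub>R D) \<le> \<epsilon> * \<bar>sigma_ts T t - s\<bar>"
      using has_delta_derivativeD[OF assms(1,3) eps] by blast
    then show ?thesis
      using assms(2,3) by simp
  qed
  then have "norm (x (sigma_ts T t) - x t - (sigma_ts T t - t) *\<^sub>R D) \<le> 0"
    by (rule le_0_if_le_eps_mult[OF _ abs_ge_zero])
  then show ?thesis
    by (simp add: algebra_simps)
qed

lemma has_delta_derivative_bounded_linear:
  fixes x :: "real \<Rightarrow> 'a::real_normed_vector"
  assumes f: "bounded_linear f" and x: "has_delta_derivative S x t D"
  shows "has_delta_derivative S (\<lambda>s. f (x s)) t (f D)"
  unfolding has_delta_derivative_def
proof (intro allI impI)
  fix \<epsilon> :: real assume "0 < \<epsilon>"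
  obtain K where "0 < K" and K: "\<And>v. norm (f v) \<le> norm v * K"
    using bounded_linear.pos_bounded[OF f] by blast
  obtain \<delta> where "0 < \<delta>" and \<delta>: "\<forall>s\<in>S. \<bar>s - t\<bar> < \<delta> \<longrightarrow>
      norm (x (sigma_ts S t) - x s - (sigma_ts S t - s) *\<^sub>R D) \<le> \<epsilon> / K * \<bar>sigma_ts S t - s\<bar>"
    using x divide_pos_pos[OF \<open>0 < \<epsilon>\<close> \<open>0 < K\<close>] unfolding has_delta_derivative_def by blast
  have "norm (f (x (sigma_ts S t)) - f (x s) - (sigma_ts S t - s) *\<^sub>R f D) \<le> \<epsilon> * \<bar>sigma_ts S t - s\<bar>"
    if "s \<in> S" "\<bar>s - t\<bar> < \<delta>" for s
  proof -
    have "f (x (sigma_ts S t)) - f (x s) - (sigma_ts S t - s) *\<^sub>R f D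
        = f (x (sigma_ts S t) - x s - (sigma_ts S t - s) *\<^sub>R D)"
      by (simp add: linear_diff[OF bounded_linear.linear[OF f]] linear_cmul[OF bounded_linear.linear[OF f]])
    also have "norm \<dots> \<le> norm (x (sigma_ts S t) - x s - (sigma_ts S t - s) *\<^sub>R D) * K"
      by (rule K)
    also have "\<dots> \<le> \<epsilon> / K * \<bar>sigma_ts S t - s\<bar> * K"
      using \<delta> that \<open>0 < K\<close> by (intro mult_right_mono) auto
    finally show ?thesis
      using \<open>0 < K\<close> by simp
  qed
  then show "\<exists>\<delta>>0. \<forall>s\<in>S. \<bar>s - t\<bar> < \<delta> \<longrightarrow>
      norm (f (x (sigma_ts S t)) - f (x s) - (sigma_ts S t - s) *\<^sub>R f D) \<le> \<epsilon> * \<bar>sigma_ts S t - s\<bar>"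
    using \<open>0 < \<delta>\<close> by blast
qed

lemma has_delta_derivative_continuous:
  fixes x :: "real \<Rightarrow> 'a::real_normed_vector"
  assumes x: "has_delta_derivative {s\<in>T. t0 \<le> s} x t D" and "t \<in> T" "t0 \<le> t" "0 < \<eta>"
  obtains \<delta> where "0 < \<delta>" "\<And>u. u \<in> T \<Longrightarrow> t0 \<le> u \<Longrightarrow> \<bar>u - t\<bar> < \<delta> \<Longrightarrow> norm (x t - x u) \<le> \<eta>"
proof -
  define \<mu> where "\<mu> = sigma_ts T t - t"
  have "0 \<le> \<mu>"
    using sigma_ts_ge[of t] by (simp add: \<mu>_def)
  then obtain \<delta>1 where "0 < \<delta>1" and \<delta>1: "\<And>u. u \<in> T \<Longrightarrow> t0 \<le> u \<Longrightarrow> \<bar>u - t\<bar> < \<delta>1 \<Longrightarrow>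
      norm (x (sigma_ts T t) - x u - (sigma_ts T t - u) *\<^sub>R D) \<le> \<eta> / (2 * (\<mu> + 1)) * \<bar>sigma_ts T t - u\<bar>"
    using has_delta_derivativeD[OF x \<open>t0 \<le> t\<close>, of "\<eta> / (2 * (\<mu> + 1))"] \<open>0 < \<eta>\<close> by auto
  define \<delta> where "\<delta> = min \<delta>1 (min 1 (\<eta> / (2 * (norm D + 1))))"
  show ?thesis
  proof
    show "0 < \<delta>"
      using \<open>0 < \<delta>1\<close> \<open>0 < \<eta>\<close> by (simp add: \<delta>_def add_nonneg_pos)
    fix u assume u: "u \<in> T" "t0 \<le> u" "\<bar>u - t\<bar> < \<delta>"
    \<comment> \<open>the jump relation \<open>x (\<sigma> t) = x t + \<mu> D\<close> turns the error at \<open>u\<close> into \<open>x t - x u\<close>\<close>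
    have split: "x t - x u = (x (sigma_ts T t) - x u - (sigma_ts T t - u) *\<^sub>R D) + (t - u) *\<^sub>R D"
      using has_delta_derivative_right_scattered[OF x \<open>t \<in> T\<close> \<open>t0 \<le> t\<close>]
      by (simp add: algebra_simps)
    have "norm (x t - x u)
        \<le> norm (x (sigma_ts T t) - x u - (sigma_ts T t - u) *\<^sub>R D) + \<bar>t - u\<bar> * norm D"
      unfolding split by (rule order.trans[OF norm_triangle_ineq]) simp
    also have "\<dots> \<le> \<eta> / (2 * (\<mu> + 1)) * (\<mu> + 1) + \<eta> / (2 * (norm D + 1)) * (norm D + 1)"
    proof (rule add_mono)
      have "norm (x (sigma_ts T t) - x u - (sigma_ts T t - u) *\<^sub>R D)
          \<le> \<eta> / (2 * (\<mu> + 1)) * \<bar>sigma_ts T t - u\<bar>"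
        using \<delta>1[OF u(1,2)] u(3) by (simp add: \<delta>_def)
      also have "\<dots> \<le> \<eta> / (2 * (\<mu> + 1)) * (\<mu> + 1)"
        using u(3) \<open>0 < \<eta>\<close> \<open>0 \<le> \<mu>\<close> by (intro mult_left_mono) (auto simp: \<delta>_def \<mu>_def)
      finally show "norm (x (sigma_ts T t) - x u - (sigma_ts T t - u) *\<^sub>R D)
          \<le> \<eta> / (2 * (\<mu> + 1)) * (\<mu> + 1)" .
      show "\<bar>t - u\<bar> * norm D \<le> \<eta> / (2 * (norm D + 1)) * (norm D + 1)"
        using u(3) by (intro mult_mono) (auto simp: \<delta>_def abs_minus_commute)
    qed
    also have "\<dots> = \<eta>"
    proof -
      have "\<mu> + 1 \<noteq> 0" "norm D + 1 \<noteq> 0"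
        using \<open>0 \<le> \<mu>\<close> norm_ge_zero[of D] by linarith+
      then have "\<eta> / (2 * (\<mu> + 1)) * (\<mu> + 1) = \<eta> / 2" "\<eta> / (2 * (norm D + 1)) * (norm D + 1) = \<eta> / 2"
        by (simp_all add: divide_simps)
      then show ?thesis
        by (simp only: field_sum_of_halves)
    qed
    finally show "norm (x t - x u) \<le> \<eta>" .
  qed
qed

text \<open>Induction along a time scale: a least counterexample \<open>m\<close> cannot exist, since \<open>P\<close>
  spreads to \<open>m\<close> from the left (through \<open>t0\<close>, a predecessor, or left-density) and beyond \<open>m\<close>
  to the right.\<close>

lemma ts_induct [consumes 2, case_names start right_scattered right_dense left_dense]:
  assumes t1: "t1 \<in> T" "t0 \<le> t1"
    and start: "P t0"
    and right_scattered: "\<And>t. t \<in> T \<Longrightarrow> t0 \<le> t \<Longrightarrow> t < sigma_ts T t \<Longrightarrow> P t \<Longrightarrow> P (sigma_ts T t)"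
    and right_dense: "\<And>t. t \<in> T \<Longrightarrow> t0 \<le> t \<Longrightarrow> sigma_ts T t = t \<Longrightarrow> P t \<Longrightarrow>
      \<exists>\<delta>>0. \<forall>u\<in>T. t < u \<and> u < t + \<delta> \<longrightarrow> P u"
    and left_dense: "\<And>t. t \<in> T \<Longrightarrow> t0 < t \<Longrightarrow> \<forall>\<delta>>0. \<exists>u\<in>T. t - \<delta> < u \<and> u < t \<Longrightarrow>
      \<forall>u\<in>T. t0 \<le> u \<and> u < t \<longrightarrow> P u \<Longrightarrow> P t"
  shows "P t1"
proof (rule ccontr)
  assume "\<not> P t1"
  define S where "S = {u\<in>T. t0 \<le> u \<and> u \<le> t1 \<and> \<not> P u}"
  define m where "m = Inf S"
  have "S \<noteq> {}" "bdd_below S"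
    using t1 \<open>\<not> P t1\<close> by (auto simp: S_def intro: bdd_belowI[of _ t0])
  have m_le: "m \<le> u" if "u \<in> S" for u
    unfolding m_def using that \<open>bdd_below S\<close> by (rule cInf_lower)
  have "m \<in> closure S"
    unfolding m_def using \<open>S \<noteq> {}\<close> \<open>bdd_below S\<close> by (rule closure_contains_Inf)
  also have "closure S \<subseteq> T \<inter> {t0..t1}"
    using closed_T by (intro closure_minimal) (auto simp: S_def)
  finally have m: "m \<in> T" "t0 \<le> m" "m \<le> t1"
    by auto
  have below: "P u" if "u \<in> T" "t0 \<le> u" "u < m" for u
    using m_le[of u] that m by (force simp: S_def)
  have "P m"
  proof (cases "m = t0 \<or> (\<forall>\<delta>>0. \<exists>u\<in>T. m - \<delta> < u \<and> u < m)")
    case True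
    then show ?thesis
      using start left_dense[OF m(1)] below m(2) by force
  next
    case False
    then obtain \<rho> where "\<rho> \<in> T" "t0 \<le> \<rho>" "\<rho> < m" "sigma_ts T \<rho> = m"
      using left_scattered_predecessor[OF t0_in_T m(1)] m(2) by (metis order_le_less)
    then show ?thesis
      using right_scattered[of \<rho>] below[of \<rho>] by auto
  qed
  have above: "\<exists>u\<in>S. m < u \<and> u < m + e" if e: "0 < e" for e
  proof -
    obtain u where "u \<in> S" "u < m + e"
      using e \<open>S \<noteq> {}\<close> \<open>bdd_below S\<close> cInf_less_iff[of S "m + e"] by (auto simp: m_def)
    moreover have "m \<noteq> u"
      using \<open>P m\<close> \<open>u \<in> S\<close> by (auto simp: S_def)
    ultimately show ?thesis
      using m_le by force
  qed
  show False
  proof (cases "m < sigma_ts T m")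
    case True
    then obtain u where "u \<in> S" "m < u" "u < sigma_ts T m"
      using above[of "sigma_ts T m - m"] by auto
    then show False
      using sigma_ts_le[of u m] by (auto simp: S_def)
  next
    case False
    then obtain \<delta> where "0 < \<delta>" "\<forall>u\<in>T. m < u \<and> u < m + \<delta> \<longrightarrow> P u"
      using right_dense[OF m(1,2) _ \<open>P m\<close>] sigma_ts_ge[of m] by force
    then show False
      using above[of \<delta>] by (auto simp: S_def)
  qed
qed

text \<open>Here \<open>y(\<sigma> s) \<le> (1 - c \<mu>) y(s)\<close>, which is at most \<open>e\<^sup>-\<^sup>c\<^sup>\<mu> y(s)\<close> if \<open>c \<mu> \<le> 1\<close> and nonpositive
  otherwise; this is why no bound on the graininess \<open>\<mu>\<close> is needed.\<close>

lemma decay_step_right_scattered: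
  fixes y :: "real \<Rightarrow> real"
  assumes "has_delta_derivative {s\<in>T. t0 \<le> s} y s y's" "s \<in> T" "t0 \<le> s"
    and "y's \<le> - c * y s" "0 \<le> y s" "y s \<le> b" "0 \<le> b" "0 < c"
  shows "y (sigma_ts T s) \<le> b * exp (- (c / 2) * (sigma_ts T s - s))"
proof -
  let ?\<mu> = "sigma_ts T s - s"
  have "0 \<le> ?\<mu>"
    using sigma_ts_ge[of s] by simp
  have "y (sigma_ts T s) = y s + ?\<mu> * y's"
    using has_delta_derivative_right_scattered[OF assms(1-3)] by simp
  also have "\<dots> \<le> (1 - c * ?\<mu>) * y s"
    using assms(4) mult_left_mono[OF assms(4) \<open>0 \<le> ?\<mu>\<close>] by (simp add: algebra_simps)
  also have "\<dots> \<le> b * exp (- (c / 2) * ?\<mu>)"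
  proof (cases "0 \<le> 1 - c * ?\<mu>")
    case True
    have "1 - c * ?\<mu> \<le> exp (- (c * ?\<mu>))"
      using exp_ge_add_one_self[of "- (c * ?\<mu>)"] by simp
    also have "\<dots> \<le> exp (- (c / 2) * ?\<mu>)"
      using \<open>0 \<le> ?\<mu>\<close> \<open>0 < c\<close> by (simp add: mult_right_mono)
    finally show ?thesis
      using True assms(5-7) by (simp add: mult_mono mult.commute)
  next
    case False
    then have "(1 - c * ?\<mu>) * y s \<le> 0"
      using assms(5) by (simp add: mult_nonpos_nonneg)
    moreover have "0 \<le> b * exp (- (c / 2) * ?\<mu>)"
      using assms(7) by simp
    ultimately show ?thesis
      by linarith
  qed
  finally show ?thesis .
qed

lemma decay_step_right_dense:
  fixes y :: "real \<Rightarrow> real"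
  assumes der: "has_delta_derivative {s\<in>T. t0 \<le> s} y s y's" and s: "s \<in> T" "t0 \<le> s" "sigma_ts T s = s"
    and "y's \<le> - c * y s" "y s \<le> b" "0 < b" "0 < c"
  obtains \<delta> where "0 < \<delta>" "\<And>u. u \<in> T \<Longrightarrow> s < u \<Longrightarrow> u < s + \<delta> \<Longrightarrow> y u \<le> b * exp (- (c / 2) * (u - s))"
proof -
  obtain \<delta> where "0 < \<delta>" and \<delta>: "\<And>u. u \<in> T \<Longrightarrow> t0 \<le> u \<Longrightarrow> \<bar>u - s\<bar> < \<delta> \<Longrightarrow>
      norm (y (sigma_ts T s) - y u - (sigma_ts T s - u) *\<^sub>R y's) \<le> c / 2 * b * \<bar>sigma_ts T s - u\<bar>"
    using has_delta_derivativeD[OF der s(2), of "c / 2 * b"] \<open>0 < b\<close> \<open>0 < c\<close> by auto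
  have "y u \<le> b * exp (- (c / 2) * (u - s))" if u: "u \<in> T" "s < u" "u < s + min \<delta> (1 / c)" for u
  proof -
    have "u - s < 1 / c"
      using u by simp
    then have "c * (u - s) \<le> 1"
      using \<open>0 < c\<close> by (simp add: pos_less_divide_eq mult.commute)
    have "\<bar>y s - y u - (s - u) * y's\<bar> \<le> c / 2 * b * (u - s)"
      using \<delta>[of u] u s by simp
    then have "y u \<le> y s - (s - u) * y's + c / 2 * b * (u - s)"
      using abs_le_D2 by fastforce
    also have "\<dots> \<le> (1 - c * (u - s)) * y s + c / 2 * b * (u - s)"
      using assms(5) u mult_left_mono[of y's "- c * y s" "u - s"] by (simp add: algebra_simps)
    also have "\<dots> \<le> (1 - c * (u - s)) * b + c / 2 * b * (u - s)"
      using assms(6) \<open>c * (u - s) \<le> 1\<close> by (simp add: mult_left_mono)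
    also have "\<dots> = b * (1 + - (c / 2) * (u - s))"
      by (simp add: algebra_simps)
    also have "\<dots> \<le> b * exp (- (c / 2) * (u - s))"
      using \<open>0 < b\<close> exp_ge_add_one_self[of "- (c / 2) * (u - s)"] by (intro mult_left_mono) auto
    finally show ?thesis .
  qed
  then show ?thesis
    using that[of "min \<delta> (1 / c)"] \<open>0 < \<delta>\<close> \<open>0 < c\<close> by auto
qed

lemma le_at_left_dense:
  fixes y g :: "real \<Rightarrow> real"
  assumes der: "has_delta_derivative {s\<in>T. t0 \<le> s} y s y's" and s: "s \<in> T" "t0 < s"
    and left_dense: "\<forall>\<delta>>0. \<exists>u\<in>T. s - \<delta> < u \<and> u < s"
    and "isCont g s" and below: "\<And>u. u \<in> T \<Longrightarrow> t0 \<le> u \<Longrightarrow> u < s \<Longrightarrow> y u \<le> g u"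
  shows "y s \<le> g s"
proof -
  have "y s - g s \<le> \<gamma> * 2" if "0 < \<gamma>" for \<gamma>
  proof -
    obtain \<delta>1 where "0 < \<delta>1" and \<delta>1: "\<And>u. u \<in> T \<Longrightarrow> t0 \<le> u \<Longrightarrow> \<bar>u - s\<bar> < \<delta>1 \<Longrightarrow>
        norm (y s - y u) \<le> \<gamma>"
      using has_delta_derivative_continuous[OF der s(1) _ \<open>0 < \<gamma>\<close>] s by auto
    obtain \<delta>2 where "0 < \<delta>2" and \<delta>2: "\<And>u. \<bar>u - s\<bar> < \<delta>2 \<Longrightarrow> \<bar>g u - g s\<bar> < \<gamma>"
      using \<open>isCont g s\<close> \<open>0 < \<gamma>\<close> unfolding continuous_at_eps_delta dist_real_def by blast
    have "0 < min (min \<delta>1 \<delta>2) (s - t0)"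
      using \<open>0 < \<delta>1\<close> \<open>0 < \<delta>2\<close> s(2) by simp
    then obtain u where "u \<in> T" "s - min (min \<delta>1 \<delta>2) (s - t0) < u" "u < s"
      using left_dense by blast
    then have "y u \<le> g u" "\<bar>g u - g s\<bar> < \<gamma>" "norm (y s - y u) \<le> \<gamma>"
      using below \<delta>1 \<delta>2 by auto
    then show ?thesis
      by auto
  qed
  then have "y s - g s \<le> 0"
    using le_0_if_le_eps_mult[of "y s - g s" 2] by simp
  then show ?thesis
    by simp
qed

text \<open>Halving the rate leaves room for the error term at right-dense points; the margin \<open>\<eta>\<close>
  keeps the comparison function positive.\<close>

lemma delta_derivative_decay:
  fixes y y' :: "real \<Rightarrow> real"
  assumes der: "\<And>s. s \<in> T \<Longrightarrow> t0 \<le> s \<Longrightarrow> has_delta_derivative {s\<in>T. t0 \<le> s} y s (y' s)"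
    and decay: "\<And>s. s \<in> T \<Longrightarrow> t0 \<le> s \<Longrightarrow> y' s \<le> - c * y s"
    and nonneg: "\<And>s. s \<in> T \<Longrightarrow> t0 \<le> s \<Longrightarrow> 0 \<le> y s"
    and "0 < c" and t: "t \<in> T" "t0 \<le> t"
  shows "y t \<le> exp (- (c / 2) * (t - t0)) * y t0"
proof -
  have "y t \<le> (y t0 + \<eta>) * exp (- (c / 2) * (t - t0))" if "0 < \<eta>" for \<eta>
  proof -
    define B where "B s = (y t0 + \<eta>) * exp (- (c / 2) * (s - t0))" for s
    have B_pos: "0 < B s" for s
      using \<open>0 < \<eta>\<close> nonneg[OF t0_in_T] by (simp add: B_def)
    have B_shift: "B u = B s * exp (- (c / 2) * (u - s))" for u s
    proof -
      have "- (c / 2) * (u - t0) = - (c / 2) * (s - t0) + - (c / 2) * (u - s)"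
        by (simp add: right_diff_distrib)
      then have "exp (- (c / 2) * (u - t0)) = exp (- (c / 2) * (s - t0)) * exp (- (c / 2) * (u - s))"
        by (simp add: exp_add[symmetric])
      then show ?thesis
        by (simp add: B_def)
    qed
    from t have "y t \<le> B t"
    proof (induction rule: ts_induct)
      case start
      then show ?case
        using \<open>0 < \<eta>\<close> by (simp add: B_def)
    next
      case (right_scattered s)
      then show ?case
        using decay_step_right_scattered[OF der _ _ decay nonneg] B_pos[of s] \<open>0 < c\<close>
        by (simp add: B_shift[of "sigma_ts T s" s] less_imp_le)
    next
      case (right_dense s)
      then obtain \<delta> where "0 < \<delta>" and \<delta>:
          "\<And>u. u \<in> T \<Longrightarrow> s < u \<Longrightarrow> u < s + \<delta> \<Longrightarrow> y u \<le> B s * exp (- (c / 2) * (u - s))"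
        using decay_step_right_dense[OF der _ _ _ decay _ B_pos \<open>0 < c\<close>] by metis
      have "y u \<le> B u" if "u \<in> T" "s < u" "u < s + \<delta>" for u
        using \<delta>[OF that] B_shift[of u s] by simp
      then show ?case
        using \<open>0 < \<delta>\<close> by blast
    next
      case (left_dense s)
      have "isCont B s"
        unfolding B_def by (intro continuous_intros)
      then show ?case
        using le_at_left_dense[OF der[of s] left_dense.hyps(1,2,3)] left_dense left_dense.IH
        by auto
    qed
    then show ?thesis
      by (simp add: B_def)
  qed
  then have "y t - y t0 * exp (- (c / 2) * (t - t0)) \<le> 0"
    by (intro le_0_if_le_eps_mult[where c = "exp (- (c / 2) * (t - t0))"]) (auto simp: algebra_simps)
  then show ?thesis
    by (simp add: mult.commute)
qed

lemma has_delta_derivative_component_neg: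
  fixes x :: "real \<Rightarrow> real^'n"
  assumes der: "has_delta_derivative {s\<in>T. t0 \<le> s} x t0 D" and "x t0 $ i = 0" "D $ i < 0"
  obtains u where "u \<in> T" "t0 < u" "x u $ i < 0"
proof (cases "t0 < sigma_ts T t0")
  case True
  have "x (sigma_ts T t0) = x t0 + (sigma_ts T t0 - t0) *\<^sub>R D"
    using has_delta_derivative_right_scattered[OF der t0_in_T] by simp
  then have "x (sigma_ts T t0) $ i = (sigma_ts T t0 - t0) * D $ i"
    using assms(2) by simp
  also have "\<dots> < 0"
    using True assms(3) by (simp add: mult_pos_neg)
  finally show ?thesis
    using that sigma_ts_in[OF t0_in_T] True by blast
next
  case False
  then have right_dense: "sigma_ts T t0 = t0"
    using sigma_ts_ge[of t0] by simp
  obtain \<delta> where "0 < \<delta>" and \<delta>: "\<And>s. s \<in> T \<Longrightarrow> t0 \<le> s \<Longrightarrow> \<bar>s - t0\<bar> < \<delta> \<Longrightarrow>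
      norm (x (sigma_ts T t0) - x s - (sigma_ts T t0 - s) *\<^sub>R D) \<le> - D $ i / 2 * \<bar>sigma_ts T t0 - s\<bar>"
    using has_delta_derivativeD[OF der order_refl, of "- D $ i / 2"] assms(3) by auto
  obtain u where u: "u \<in> T" "t0 < u" "u < t0 + \<delta>"
    using right_dense_approach[OF right_dense \<open>0 < \<delta>\<close>] by blast
  have "\<bar>(x t0 - x u - (t0 - u) *\<^sub>R D) $ i\<bar> \<le> norm (x t0 - x u - (t0 - u) *\<^sub>R D)"
    by (rule component_le_norm_cart)
  also have "\<dots> \<le> - D $ i / 2 * (u - t0)"
    using \<delta>[of u] u right_dense by simp
  finally have "\<bar>- x u $ i - (t0 - u) * D $ i\<bar> \<le> - D $ i / 2 * (u - t0)"
    using assms(2) by simp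
  then have "- (- x u $ i - (t0 - u) * D $ i) \<le> - D $ i / 2 * (u - t0)"
    by (rule abs_le_D2)
  then have "x u $ i \<le> (u - t0) * (D $ i / 2)"
    by (simp add: field_simps)
  also have "\<dots> < 0"
    using u assms(3) by (simp add: mult_pos_neg)
  finally show ?thesis
    using that u by blast
qed

lemma ts_exp_series_nonneg_eigenvector:
  fixes A :: "real^'n^'n"
  assumes "A *v w = s *\<^sub>R w" "0 \<le> s" "t0 \<le> t"
  shows "norm w \<le> norm (ts_exp_series T t0 A w t)"
proof -
  have power: "((*v) A ^^ k) w = s^k *\<^sub>R w" for k
    by (induction k) (auto simp: matrix_vector_mult_scaleR assms(1))
  have "(\<lambda>k. h k t * s^k) sums (\<Sum>k. h k t * s^k)"
  proof (rule summable_sums, rule summable_comparison_test'[OF summable_exp[of "s * (t - t0)"]])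
    fix k
    have "norm (h k t * s^k) = h k t * s^k"
      using ts_monomial_nonneg[OF assms(3)] assms(2) by simp
    also have "\<dots> \<le> (t - t0)^k / fact k * s^k"
      using ts_monomial_le_power[OF assms(3)] assms(2) by (intro mult_right_mono) auto
    finally show "norm (h k t * s^k) \<le> inverse (fact k) * (s * (t - t0))^k"
      by (simp add: power_mult_distrib divide_inverse mult_ac)
  qed
  moreover have "0 \<le> h k t * s^k" for k
    using ts_monomial_nonneg[OF assms(3)] assms(2) by simp
  ultimately have "1 \<le> (\<Sum>k. h k t * s^k)"
    using sum_le_suminf[of "\<lambda>k. h k t * s^k" "{..<1}"] by (auto simp: sums_iff)
  moreover have "ts_exp_series T t0 A w t = (\<Sum>k. h k t * s^k) *\<^sub>R w"
    using ts_exp_series_sums[OF assms(3), of A w] \<open>(\<lambda>k. h k t * s^k) sums _\<close>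
    by (simp add: power sums_unique2 sums_scaleR_left)
  ultimately show ?thesis
    by (simp add: mult_le_cancel_right1)
qed

end

lemma forward_time_scale_intro:
  assumes "time_scale T" "\<forall>r. \<exists>t\<in>T. r < t" "t0 \<in> T"
  shows "forward_time_scale T t0"
  using assms by unfold_locales (auto simp: time_scale_def)

section \<open>Positive systems\<close>

lemma metzler_if_positive_system:
  fixes A :: "real^'n^'n"
  assumes "time_scale T" "\<forall>r. \<exists>t\<in>T. r < t" and pos: "positive_system T A"
  shows "metzler A"
  unfolding metzler_def
proof (intro allI impI, rule ccontr)
  fix i j :: 'n assume "i \<noteq> j" "\<not> 0 \<le> A$i$j"
  obtain t0 where "t0 \<in> T"
    using assms(1) by (auto simp: time_scale_def)
  then interpret forward_time_scale T t0
    using assms(1,2) by (rule forward_time_scale_intro[rotated -1])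
  define x where "x = ts_exp_series T t0 A (axis j 1)"
  have sol: "forward_solution T A t0 (axis j 1) x"
    unfolding x_def by (rule forward_solution_ts_exp_series)
  then have "has_delta_derivative {s\<in>T. t0 \<le> s} x t0 (A *v x t0)" "x t0 = axis j 1"
    using t0_in_T by (auto simp: forward_solution_def)
  moreover have "(A *v axis j 1) $ i = A$i$j"
    by (simp add: matrix_vector_mult_def axis_def if_distrib[of "\<lambda>a. _ * a"] cong: if_cong)
  ultimately obtain u where "u \<in> T" "t0 < u" "x u $ i < 0"
    using has_delta_derivative_component_neg[of x "A *v x t0" i] \<open>i \<noteq> j\<close> \<open>\<not> 0 \<le> A$i$j\<close>
    by (auto simp: axis_def)
  moreover have "nonneg_vec (axis j (1::real))"
    by (simp add: nonneg_vec_def axis_def)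
  ultimately show False
    using pos sol t0_in_T unfolding positive_system_def nonneg_vec_def
    by (meson less_imp_le not_le)
qed

lemma not_stable_if_nonneg_eigenpair:
  fixes A :: "real^'n^'n"
  assumes "time_scale T" "\<forall>r. \<exists>t\<in>T. r < t" and "nonneg_eigenpair A"
  shows "\<not> pos_unif_exp_stable T A"
proof
  assume "pos_unif_exp_stable T A"
  then obtain K \<alpha> V where "1 \<le> K" "0 < \<alpha>" "open V" "0 \<in> V" and stable:
      "\<And>t0 t x0 x. t0 \<in> T \<Longrightarrow> t \<in> T \<Longrightarrow> t0 \<le> t \<Longrightarrow> nonneg_vec x0 \<Longrightarrow> x0 \<in> V \<Longrightarrow>
        forward_solution T A t0 x0 x \<Longrightarrow> norm (x t) \<le> K * exp (- \<alpha> * (t - t0)) * norm x0"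
    unfolding pos_unif_exp_stable_def by metis
  obtain w s where w: "nonneg_vec w" "w \<noteq> 0" "0 \<le> s" "A *v w = s *\<^sub>R w"
    using assms(3) unfolding nonneg_eigenpair_def by blast
  obtain t0 where "t0 \<in> T"
    using assms(1) by (auto simp: time_scale_def)
  then interpret forward_time_scale T t0
    using assms(1,2) by (rule forward_time_scale_intro[rotated -1])
  obtain \<rho> where "0 < \<rho>" "ball 0 \<rho> \<subseteq> V"
    using \<open>open V\<close> \<open>0 \<in> V\<close> open_contains_ball by blast
  define x0 where "x0 = (\<rho> / (2 * norm w)) *\<^sub>R w"
  have "norm x0 = \<rho> / 2"
    using w(2) \<open>0 < \<rho>\<close> by (simp add: x0_def)
  then have "x0 \<in> V" "0 < norm x0"
    using \<open>0 < \<rho>\<close> \<open>ball 0 \<rho> \<subseteq> V\<close> by auto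
  have "nonneg_vec x0"
    using w(1) \<open>0 < \<rho>\<close> by (simp add: x0_def nonneg_vec_def)
  have "A *v x0 = s *\<^sub>R x0"
    using w(4) by (simp add: x0_def matrix_vector_mult_scaleR)
  obtain t where "t \<in> T" "t0 + (\<bar>ln K\<bar> + 1) / \<alpha> < t"
    using assms(2) by blast
  then have "(\<bar>ln K\<bar> + 1) / \<alpha> < t - t0"
    by linarith
  moreover have "0 \<le> (\<bar>ln K\<bar> + 1) / \<alpha>"
    using \<open>0 < \<alpha>\<close> by simp
  ultimately have "t0 \<le> t" "\<bar>ln K\<bar> + 1 < (t - t0) * \<alpha>"
    by (linarith, simp add: pos_divide_less_eq[OF \<open>0 < \<alpha>\<close>])
  then have "ln K < \<alpha> * (t - t0)"
    by (simp add: mult.commute)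
  then have "exp (- \<alpha> * (t - t0)) < exp (- ln K)"
    by simp
  also have "\<dots> = 1 / K"
    using \<open>1 \<le> K\<close> by (simp add: exp_minus inverse_eq_divide)
  finally have "K * exp (- \<alpha> * (t - t0)) < 1"
    using \<open>1 \<le> K\<close> by (simp add: field_simps)
  moreover have "norm x0 \<le> K * exp (- \<alpha> * (t - t0)) * norm x0"
    using ts_exp_series_nonneg_eigenvector[OF \<open>A *v x0 = s *\<^sub>R x0\<close> w(3) \<open>t0 \<le> t\<close>]
      stable[OF t0_in_T \<open>t \<in> T\<close> \<open>t0 \<le> t\<close> \<open>nonneg_vec x0\<close> \<open>x0 \<in> V\<close> forward_solution_ts_exp_series]
    by linarith
  ultimately show False
    using \<open>0 < norm x0\<close> by (simp add: mult_le_cancel_right1)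
qed

lemma copositive_lyapunov_rate:
  fixes A :: "real^'n^'n"
  assumes "copositive_lyapunov A v"
  obtains c where "0 < c" "\<And>j. (v v* A)$j \<le> - c * v$j"
proof
  define c where "c = Min (range (\<lambda>j. - (v v* A)$j / v$j))"
  show "0 < c"
    using assms by (auto simp: c_def copositive_lyapunov_def divide_neg_pos)
  fix j
  have "c \<le> - (v v* A)$j / v$j"
    unfolding c_def by (rule Min_le) auto
  then show "(v v* A)$j \<le> - c * v$j"
    using assms by (auto simp: copositive_lyapunov_def field_simps)
qed

lemma inner_ge_if_nonneg:
  fixes v x :: "real^'n"
  assumes "nonneg_vec x" "\<And>i. m \<le> v$i" "0 \<le> m"
  shows "m * norm x \<le> v \<bullet> x"
proof -
  have "m * norm x \<le> m * (\<Sum>i\<in>UNIV. \<bar>x$i\<bar>)"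
    using norm_le_l1_cart[of x] assms(3) by (rule mult_left_mono)
  also have "\<dots> \<le> (\<Sum>i\<in>UNIV. v$i * x$i)"
    using assms by (auto simp: sum_distrib_left nonneg_vec_def intro!: sum_mono mult_right_mono)
  finally show ?thesis
    by (simp add: inner_vec_def)
qed

lemma stable_if_copositive_lyapunov:
  fixes A :: "real^'n^'n"
  assumes "time_scale T" "\<forall>r. \<exists>t\<in>T. r < t" and pos: "positive_system T A"
    and lyap: "copositive_lyapunov A v"
  shows "pos_unif_exp_stable T A"
proof -
  obtain c where "0 < c" and c: "\<And>j. (v v* A)$j \<le> - c * v$j"
    using copositive_lyapunov_rate[OF lyap] by blast
  define m where "m = Min (range (($) v))"
  have "0 < m" "\<And>i. m \<le> v$i"
    using lyap by (auto simp: m_def copositive_lyapunov_def)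
  define K where "K = max 1 (norm v / m)"
  have "norm (x t) \<le> K * exp (- (c / 2) * (t - t0)) * norm x0"
    if "t0 \<in> T" "t \<in> T" "t0 \<le> t" "nonneg_vec x0" and sol: "forward_solution T A t0 x0 x"
    for t0 t x0 x
  proof -
    interpret forward_time_scale T t0
      using assms(1,2) \<open>t0 \<in> T\<close> by (rule forward_time_scale_intro)
    have x_nonneg: "nonneg_vec (x s)" if "s \<in> T" "t0 \<le> s" for s
      using pos sol that \<open>t0 \<in> T\<close> \<open>nonneg_vec x0\<close> unfolding positive_system_def by blast
    have "v \<bullet> x t \<le> exp (- (c / 2) * (t - t0)) * (v \<bullet> x t0)"
    proof (rule delta_derivative_decay[OF _ _ _ \<open>0 < c\<close> \<open>t \<in> T\<close> \<open>t0 \<le> t\<close>])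
      fix s assume s: "s \<in> T" "t0 \<le> s"
      show "has_delta_derivative {s\<in>T. t0 \<le> s} (\<lambda>s. v \<bullet> x s) s (v \<bullet> (A *v x s))"
        using sol s bounded_linear_inner_right
        by (auto simp: forward_solution_def intro: has_delta_derivative_bounded_linear)
      have "v \<bullet> (A *v x s) = (v v* A) \<bullet> x s"
        by (simp add: dot_lmul_matrix)
      also have "\<dots> = (\<Sum>j\<in>UNIV. (v v* A)$j * x s $ j)"
        by (simp add: inner_vec_def)
      also have "\<dots> \<le> (\<Sum>j\<in>UNIV. (- c * v$j) * x s $ j)"
        using c x_nonneg[OF s] by (intro sum_mono mult_right_mono) (auto simp: nonneg_vec_def)
      finally show "v \<bullet> (A *v x s) \<le> - c * (v \<bullet> x s)"
        by (simp add: inner_vec_def sum_distrib_left mult.assoc)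
      show "0 \<le> v \<bullet> x s"
        using inner_ge_if_nonneg[OF x_nonneg[OF s] \<open>\<And>i. m \<le> v$i\<close>] \<open>0 < m\<close>
        by (meson less_imp_le mult_nonneg_nonneg norm_ge_zero order.trans)
    qed
    moreover have "x t0 = x0"
      using sol by (simp add: forward_solution_def)
    ultimately have "m * norm (x t) \<le> exp (- (c / 2) * (t - t0)) * (norm v * norm x0)"
      using inner_ge_if_nonneg[OF x_nonneg[OF \<open>t \<in> T\<close> \<open>t0 \<le> t\<close>] \<open>\<And>i. m \<le> v$i\<close>] \<open>0 < m\<close>
        norm_cauchy_schwarz[of v x0]
      by (smt (verit, best) exp_gt_zero mult_left_mono)
    then have "norm (x t) \<le> norm v / m * exp (- (c / 2) * (t - t0)) * norm x0"
      using \<open>0 < m\<close> by (simp add: field_simps)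
    also have "\<dots> \<le> K * exp (- (c / 2) * (t - t0)) * norm x0"
      by (intro mult_right_mono) (auto simp: K_def)
    finally show ?thesis .
  qed
  then show ?thesis
    unfolding pos_unif_exp_stable_def using \<open>0 < c\<close>
    by (intro exI[of _ K] exI[of _ "c / 2"] exI[of _ UNIV]) (auto simp: K_def)
qed

theorem theorem4:
  fixes T :: "real set" and A :: "real^'n^'n"
  assumes "time_scale T"
    and "\<forall>r. \<exists>t\<in>T. t > r"
    and "\<exists>M. \<forall>t\<in>T. graininess T t \<le> M"
    and "positive_system T A"
  shows "pos_unif_exp_stable T A \<longleftrightarrow> (\<forall>k \<le> CARD('n). coeff (charpoly A) k > 0)"
proof -
  have metzler: "metzler A"
    using metzler_if_positive_system[OF assms(1,2,4)] .
  have coeffs: "(\<forall>k \<le> CARD('n). coeff (charpoly A) k > 0) \<longleftrightarrow> pos_coeffs (charpoly A)"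
    by (simp add: pos_coeffs_def degree_charpoly)
  show ?thesis
  proof
    assume "pos_unif_exp_stable T A"
    then have "\<not> nonneg_eigenpair A"
      using not_stable_if_nonneg_eigenpair[OF assms(1,2)] by blast
    then obtain v where "copositive_lyapunov A v"
      using metzler_alternative[OF metzler] by blast
    then show "\<forall>k \<le> CARD('n). coeff (charpoly A) k > 0"
      using coeffs pos_coeffs_charpoly_if_copositive_lyapunov[OF metzler] by blast
  next
    assume "\<forall>k \<le> CARD('n). coeff (charpoly A) k > 0"
    then have "\<not> nonneg_eigenpair A"
      using coeffs no_nonneg_eigenpair_if_pos_coeffs by blast
    then obtain v where "copositive_lyapunov A v"
      using metzler_alternative[OF metzler] by blast
    then show "pos_unif_exp_stable T A"
      by (rule stable_if_copositive_lyapunov[OF assms(1,2,4)])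
  qed
qed

end
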